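(* Let $H$ be a finitely generated group equipped with a symmetric probability measure $\mu$ with $\mu(e_H)>0$. Let $K$ be a finitely generated group equipped with a symmetric probability measure $\eta$ with $\eta(e_K)>0$. Let $\|\cdot\|$ be a norm on $H$ with volume function $V$. Let $r$ be a positive continuous increasing function. Assume that: (1) The measure $\mu$ is strongly $(\|\cdot\|,r)$-controlled and $V(t)\simeq t^D$. (2) $r(t)=t^{1/\beta}\ell_1(t)$ where $\ell_1$ is a positive continuous slowly varying function. (3) The function $F_K(n)=-\log\eta^{(2n)}(e_K)$ satisfies $F_K(n)\simeq n^\gamma\ell_2(n)$ where $\gamma\in[0,1)$ and $\ell_2$ is a positive continuous slowly varying function. Assume also that $\ell_i(t^a)\simeq\ell_i(t)$ for all $a>0$, $i=1,2$. Then there is a constant $C\in(0,\infty)$ such that the switch-walk-switch measure $q$ on $K\wr H$ associated with the pair $\eta,\mu$ satisfies $$q^{(n)}(e)\ge\exp\left(-C\,n^{\frac{D(1-\gamma)+\gamma\beta}{D(1-\gamma)+\beta}}\,\ell_1(n)^{\frac{\beta D(1-\gamma)}{D(1-\gamma)+\beta}}\,\ell_2(n)^{\frac{\beta}{D(1-\gamma)+\beta}}\right).$$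
   Context: $f\simeq g$ means $cg\le f\le Cg$ for constants $0<c\le C<\infty$ on the relevant domain (for $V(t)\simeq t^D$: $t\ge1$). $e_H,e_K$ are the identity elements of $H,K$. A measure is symmetric if $\mu(g)=\mu(g^{-1})$; $\mu^{(n)}$ is the $n$-fold convolution power. Wreath product: $K_H$ is the group of finitely supported functions $f:H\to K$ (i.e. $f(h)\ne e_K$ for finitely many $h$) with pointwise multiplication; $H$ acts on it by $\tau_hf(h')=f(h^{-1}h')$; $K\wr H=K_H\rtimes_\tau H$ with product $(f,h)(f',h')=(f\,\tau_hf',hh')$. $K$ embeds in $K\wr H$ by sending $k$ to $(\boldsymbol k_{e_H},e_H)$, where $\boldsymbol k_{e_H}(e_H)=k$ and $\boldsymbol k_{e_H}(h)=e_K$ for $h\ne e_H$; $H$ embeds by $h\mapsto(\boldsymbol e_K,h)$, where $\boldsymbol e_K$ is the constant function $e_K$. Via these embeddings, $\mu$ and $\eta$ are viewed as probability measures on $K\wr H$, and the switch-walk-switch measure is $q=\eta*\mu*\eta$. A norm on $H$ is a function $\|\cdot\|:H\to[0,\infty)$ with $\|g\|=0$ iff $g=e_H$ and $\|gh\|\le\|g\|+\|h\|$; its volume function is $V(t)=\#\{g:\|g\|\le t\}$. The random walk driven by $\mu$ is $X_n=X_0\xi_1\cdots\xi_n$ with $(\xi_i)$ i.i.d. of law $\mu$; $\mathbf P_x$ is its law when $X_0=x$. Strong control: let $r:(0,\infty)\to(0,\infty)$ be an increasing continuous function with inverse $\rho$. A symmetric probability measure $\mu$ on $H$ is strongly $(\|\cdot\|,r)$-controlled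 if: (i) there exists $C\in(0,\infty)$ and, for any $\kappa>0$, there exists $c(\kappa)>0$ such that, for all $n\ge1$ and all $g$ with $\|g\|\le\kappa r(n)$, $c(\kappa)V(r(n))^{-1}\le\mu^{(2n)}(g)\le CV(r(n))^{-1}$; (ii) there exist $\epsilon,\gamma_1,\gamma_2\in(0,\infty)$, $\gamma_2\ge1$, such that, for all $n,\tau$ with $\frac12\rho(\tau/\gamma_1)\le n\le\rho(\tau/\gamma_1)$, $\inf_{x:\|x\|\le\tau}\mathbf P_x\big(\sup_{0\le k\le n}\|X_k\|\le\gamma_2\tau;\ \|X_n\|\le\tau\big)\ge\epsilon$. *)

theory Defs
  imports
    "HOL-Probability.Probability"
    "HOL-Algebra.Generated_Groups"
    "HOL-Algebra.Product_Groups"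
begin

definition finitely_generated_group :: "('a, 'b) monoid_scheme \<Rightarrow> bool" where
  "finitely_generated_group G \<longleftrightarrow>
     group G \<and> (\<exists>S. finite S \<and> S \<subseteq> carrier G \<and> generate G S = carrier G)"

section \<open>Wreath products\<close>

text \<open>
  The lamp group of finitely supported functions \<open>H \<rightarrow> K\<close> is the direct sum of copies of \<open>K\<close>
  indexed by \<open>carrier H\<close>; functions are extensional, i.e. \<open>undefined\<close> outside \<open>carrier H\<close>.
\<close>

definition lamp_group :: "('k, 'c) monoid_scheme \<Rightarrow> ('h, 'd) monoid_scheme \<Rightarrow> ('h \<Rightarrow> 'k) monoid" where
  "lamp_group K H = sum_group (carrier H) (\<lambda>_. K)"

definition translate :: "('h, 'd) monoid_scheme \<Rightarrow> 'h \<Rightarrow> ('h \<Rightarrow> 'k) \<Rightarrow> 'h \<Rightarrow> 'k" where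
  "translate H h f = (\<lambda>h'\<in>carrier H. f (inv\<^bsub>H\<^esub> h \<otimes>\<^bsub>H\<^esub> h'))"

definition wreath :: "('k, 'c) monoid_scheme \<Rightarrow> ('h, 'd) monoid_scheme \<Rightarrow> (('h \<Rightarrow> 'k) \<times> 'h) monoid" where
  "wreath K H =
     \<lparr>carrier = carrier (lamp_group K H) \<times> carrier H,
      monoid.mult = (\<lambda>(f, h) (f', h'). (f \<otimes>\<^bsub>lamp_group K H\<^esub> translate H h f', h \<otimes>\<^bsub>H\<^esub> h')),
      one = (\<one>\<^bsub>lamp_group K H\<^esub>, \<one>\<^bsub>H\<^esub>)\<rparr>"

definition lamp_embed ::
  "('k, 'c) monoid_scheme \<Rightarrow> ('h, 'd) monoid_scheme \<Rightarrow> 'k \<Rightarrow> ('h \<Rightarrow> 'k) \<times> 'h" where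
  "lamp_embed K H k = ((\<lambda>h\<in>carrier H. if h = \<one>\<^bsub>H\<^esub> then k else \<one>\<^bsub>K\<^esub>), \<one>\<^bsub>H\<^esub>)"

definition base_embed ::
  "('k, 'c) monoid_scheme \<Rightarrow> ('h, 'd) monoid_scheme \<Rightarrow> 'h \<Rightarrow> ('h \<Rightarrow> 'k) \<times> 'h" where
  "base_embed K H h = ((\<lambda>h'\<in>carrier H. \<one>\<^bsub>K\<^esub>), h)"

lemma carrier_lamp_group:
  assumes "group K"
  shows "carrier (lamp_group K H) =
    {f \<in> carrier H \<rightarrow>\<^sub>E carrier K. finite {h \<in> carrier H. f h \<noteq> \<one>\<^bsub>K\<^esub>}}"
  unfolding lamp_group_def using assms by (simp add: carrier_sum_group)

lemma group_lamp_group: "group K \<Longrightarrow> group (lamp_group K H)"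
  by (simp add: lamp_group_def)

lemma translate_closed:
  assumes "group K" "group H" "h \<in> carrier H" "f \<in> carrier (lamp_group K H)"
  shows "translate H h f \<in> carrier (lamp_group K H)"
proof -
  interpret H: group H by fact
  have fin: "finite {x \<in> carrier H. f x \<noteq> \<one>\<^bsub>K\<^esub>}"
    and f: "f \<in> carrier H \<rightarrow>\<^sub>E carrier K"
    using assms by (auto simp: carrier_lamp_group)
  have "{x \<in> carrier H. translate H h f x \<noteq> \<one>\<^bsub>K\<^esub>}
      \<subseteq> (\<lambda>x. h \<otimes>\<^bsub>H\<^esub> x) ` {x \<in> carrier H. f x \<noteq> \<one>\<^bsub>K\<^esub>}"
  proof
    fix x assume x: "x \<in> {x \<in> carrier H. translate H h f x \<noteq> \<one>\<^bsub>K\<^esub>}"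
    then have "x = h \<otimes>\<^bsub>H\<^esub> (inv\<^bsub>H\<^esub> h \<otimes>\<^bsub>H\<^esub> x)"
      using assms(3) by (simp flip: H.m_assoc)
    with x assms(3) show "x \<in> (\<lambda>x. h \<otimes>\<^bsub>H\<^esub> x) ` {x \<in> carrier H. f x \<noteq> \<one>\<^bsub>K\<^esub>}"
      by (intro image_eqI) (auto simp: translate_def)
  qed
  then have "finite {x \<in> carrier H. translate H h f x \<noteq> \<one>\<^bsub>K\<^esub>}"
    using fin finite_subset by blast
  moreover have "translate H h f \<in> carrier H \<rightarrow>\<^sub>E carrier K"
    using f assms(3) by (auto simp: translate_def PiE_iff)
  ultimately show ?thesis
    using assms(1) by (simp add: carrier_lamp_group)
qed

lemma group_wreath:
  assumes "group K" "group H"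
  shows "group (wreath K H)"
proof -
  interpret K: group K by fact
  interpret H: group H by fact
  interpret L: group "lamp_group K H" using assms group_lamp_group by blast
  have mult_L: "f \<otimes>\<^bsub>lamp_group K H\<^esub> g = (\<lambda>i\<in>carrier H. f i \<otimes>\<^bsub>K\<^esub> g i)" for f g
    by (simp add: lamp_group_def)
  have one_L: "\<one>\<^bsub>lamp_group K H\<^esub> = (\<lambda>i\<in>carrier H. \<one>\<^bsub>K\<^esub>)"
    by (simp add: lamp_group_def)
  have cl: "f i \<in> carrier K" if "f \<in> carrier (lamp_group K H)" "i \<in> carrier H" for f i
    using that by (auto simp: carrier_lamp_group[OF assms(1)])
  have ext: "f \<in> extensional (carrier H)" if "f \<in> carrier (lamp_group K H)" for f
    using that by (auto simp: carrier_lamp_group[OF assms(1)] PiE_def)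
  have tr_mult: "translate H h (f \<otimes>\<^bsub>lamp_group K H\<^esub> g) =
      translate H h f \<otimes>\<^bsub>lamp_group K H\<^esub> translate H h g" if "h \<in> carrier H" for h f g
    using that by (auto simp: mult_L translate_def fun_eq_iff)
  have tr_tr: "translate H h (translate H h' f) = translate H (h \<otimes>\<^bsub>H\<^esub> h') f"
    if "h \<in> carrier H" "h' \<in> carrier H" for h h' f
    using that by (auto simp: translate_def fun_eq_iff H.inv_mult_group H.m_assoc)
  have tr_one: "translate H \<one>\<^bsub>H\<^esub> f = f" if "f \<in> carrier (lamp_group K H)" for f
    using ext[OF that] by (auto simp: translate_def fun_eq_iff extensional_def)
  have tr_unit: "translate H h \<one>\<^bsub>lamp_group K H\<^esub> = \<one>\<^bsub>lamp_group K H\<^esub>" if "h \<in> carrier H" for h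
    using that by (auto simp: translate_def one_L fun_eq_iff)
  note tc = translate_closed[OF assms]
  show ?thesis
  proof (rule groupI)
    show "x \<otimes>\<^bsub>wreath K H\<^esub> y \<in> carrier (wreath K H)"
      if "x \<in> carrier (wreath K H)" "y \<in> carrier (wreath K H)" for x y
      using that by (auto simp: wreath_def tc)
    show "\<one>\<^bsub>wreath K H\<^esub> \<in> carrier (wreath K H)"
      by (auto simp: wreath_def)
    show "x \<otimes>\<^bsub>wreath K H\<^esub> y \<otimes>\<^bsub>wreath K H\<^esub> z = x \<otimes>\<^bsub>wreath K H\<^esub> (y \<otimes>\<^bsub>wreath K H\<^esub> z)"
      if "x \<in> carrier (wreath K H)" "y \<in> carrier (wreath K H)" "z \<in> carrier (wreath K H)" for x y z
      using that by (auto simp: wreath_def tc tr_mult tr_tr L.m_assoc H.m_assoc)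
    show "\<one>\<^bsub>wreath K H\<^esub> \<otimes>\<^bsub>wreath K H\<^esub> x = x" if "x \<in> carrier (wreath K H)" for x
      using that by (auto simp: wreath_def tr_one)
    show "\<exists>y\<in>carrier (wreath K H). y \<otimes>\<^bsub>wreath K H\<^esub> x = \<one>\<^bsub>wreath K H\<^esub>"
      if x: "x \<in> carrier (wreath K H)" for x
    proof -
      obtain f h where fh: "x = (f, h)" "f \<in> carrier (lamp_group K H)" "h \<in> carrier H"
        using x by (auto simp: wreath_def)
      show ?thesis
        by (rule bexI[of _ "(translate H (inv\<^bsub>H\<^esub> h) (inv\<^bsub>lamp_group K H\<^esub> f), inv\<^bsub>H\<^esub> h)"])
          (use fh in \<open>auto simp: wreath_def tc tr_unit simp flip: tr_mult\<close>)
    qed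
  qed
qed

section \<open>Probability measures on groups\<close>

text \<open>
  A finitely generated group is countable, so a probability measure on it is the same as a
  probability mass function on the ambient type whose support lies in the carrier.
\<close>

definition symmetric_pmf :: "('a, 'b) monoid_scheme \<Rightarrow> 'a pmf \<Rightarrow> bool" where
  "symmetric_pmf G \<mu> \<longleftrightarrow>
     set_pmf \<mu> \<subseteq> carrier G \<and> (\<forall>g\<in>carrier G. pmf \<mu> g = pmf \<mu> (inv\<^bsub>G\<^esub> g))"

definition conv_pmf :: "('a, 'b) monoid_scheme \<Rightarrow> 'a pmf \<Rightarrow> 'a pmf \<Rightarrow> 'a pmf" where
  "conv_pmf G \<mu> \<nu> = map_pmf (\<lambda>(x, y). x \<otimes>\<^bsub>G\<^esub> y) (pair_pmf \<mu> \<nu>)"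

primrec conv_power :: "('a, 'b) monoid_scheme \<Rightarrow> 'a pmf \<Rightarrow> nat \<Rightarrow> 'a pmf" where
  "conv_power G \<mu> 0 = return_pmf \<one>\<^bsub>G\<^esub>"
| "conv_power G \<mu> (Suc n) = conv_pmf G (conv_power G \<mu> n) \<mu>"

definition switch_walk_switch ::
  "('k, 'c) monoid_scheme \<Rightarrow> ('h, 'd) monoid_scheme \<Rightarrow> 'k pmf \<Rightarrow> 'h pmf \<Rightarrow> (('h \<Rightarrow> 'k) \<times> 'h) pmf" where
  "switch_walk_switch K H \<eta> \<mu> =
     conv_pmf (wreath K H)
       (conv_pmf (wreath K H) (map_pmf (lamp_embed K H) \<eta>) (map_pmf (base_embed K H) \<mu>))
       (map_pmf (lamp_embed K H) \<eta>)"

text \<open>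
  \<open>walk_at G x \<xi>s k\<close> is \<open>X\<^sub>k = x \<xi>\<^sub>1 \<dots> \<xi>\<^sub>k\<close>.  An event that only involves \<open>X\<^sub>0, \<dots>, X\<^sub>n\<close> has
  \<open>\<^bold>P\<^sub>x\<close>-probability equal to its probability under the law \<open>replicate_pmf n \<mu>\<close> of the i.i.d.
  increments \<open>\<xi>\<^sub>1, \<dots>, \<xi>\<^sub>n\<close>.
\<close>

definition walk_at :: "('a, 'b) monoid_scheme \<Rightarrow> 'a \<Rightarrow> 'a list \<Rightarrow> nat \<Rightarrow> 'a" where
  "walk_at G x \<xi>s k = foldl (\<otimes>\<^bsub>G\<^esub>) x (take k \<xi>s)"

section \<open>Norms and strong control\<close>

definition group_norm :: "('a, 'b) monoid_scheme \<Rightarrow> ('a \<Rightarrow> real) \<Rightarrow> bool" where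
  "group_norm G N \<longleftrightarrow>
     (\<forall>g\<in>carrier G. 0 \<le> N g \<and> (N g = 0 \<longleftrightarrow> g = \<one>\<^bsub>G\<^esub>)) \<and>
     (\<forall>g\<in>carrier G. \<forall>h\<in>carrier G. N (g \<otimes>\<^bsub>G\<^esub> h) \<le> N g + N h)"

text \<open>
  The cardinality of an infinite ball would be \<open>0\<close> here; any lower bound
  \<open>c * t powr D \<le> ball_volume G N t\<close> with \<open>c > 0\<close> for all \<open>t \<ge> 1\<close> excludes infinite balls.
\<close>

definition ball_volume :: "('a, 'b) monoid_scheme \<Rightarrow> ('a \<Rightarrow> real) \<Rightarrow> real \<Rightarrow> real" where
  "ball_volume G N t = real (card {g \<in> carrier G. N g \<le> t})"

text \<open>
  The inverse \<open>\<rho>\<close> of \<open>r\<close> is defined on the range of \<open>r\<close>; when \<open>r\<close> is not onto \<open>(0, \<infinity>)\<close>, the second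
  condition only concerns those \<open>\<tau>\<close> for which \<open>\<rho> (\<tau> / \<gamma>\<^sub>1)\<close> makes sense.
\<close>

definition strongly_controlled ::
  "('a, 'b) monoid_scheme \<Rightarrow> 'a pmf \<Rightarrow> ('a \<Rightarrow> real) \<Rightarrow> (real \<Rightarrow> real) \<Rightarrow> bool" where
  "strongly_controlled G \<mu> N r \<longleftrightarrow>
     (\<exists>C>0. \<forall>\<kappa>>0. \<exists>c>0. \<forall>n\<ge>1. \<forall>g\<in>carrier G. N g \<le> \<kappa> * r (real n) \<longrightarrow>
        c * inverse (ball_volume G N (r (real n))) \<le> pmf (conv_power G \<mu> (2 * n)) g \<and>
        pmf (conv_power G \<mu> (2 * n)) g \<le> C * inverse (ball_volume G N (r (real n)))) \<and>
     (let \<rho> = inv_into {0<..} r in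
      \<exists>\<epsilon>>0. \<exists>\<gamma>\<^sub>1>0. \<exists>\<gamma>\<^sub>2\<ge>1. \<forall>n::nat. \<forall>\<tau>.
        \<tau> / \<gamma>\<^sub>1 \<in> r ` {0<..} \<longrightarrow> \<rho> (\<tau> / \<gamma>\<^sub>1) / 2 \<le> real n \<longrightarrow> real n \<le> \<rho> (\<tau> / \<gamma>\<^sub>1) \<longrightarrow>
        (INF x\<in>{x \<in> carrier G. N x \<le> \<tau>}.
           measure_pmf.prob (replicate_pmf n \<mu>)
             {\<xi>s. (SUP k\<in>{0..n}. N (walk_at G x \<xi>s k)) \<le> \<gamma>\<^sub>2 * \<tau> \<and> N (walk_at G x \<xi>s n) \<le> \<tau>}) \<ge> \<epsilon>)"

section \<open>Comparison of functions\<close>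

definition comparable_on :: "'a set \<Rightarrow> ('a \<Rightarrow> real) \<Rightarrow> ('a \<Rightarrow> real) \<Rightarrow> bool" where
  "comparable_on S f g \<longleftrightarrow>
     (\<exists>c C. 0 < c \<and> c \<le> C \<and> (\<forall>x\<in>S. c * g x \<le> f x \<and> f x \<le> C * g x))"

definition slowly_varying :: "(real \<Rightarrow> real) \<Rightarrow> bool" where
  "slowly_varying l \<longleftrightarrow> (\<forall>a>0. ((\<lambda>t. l (a * t) / l t) \<longlongrightarrow> 1) at_top)"

definition pos_cont_slowly_varying :: "(real \<Rightarrow> real) \<Rightarrow> bool" where
  "pos_cont_slowly_varying l \<longleftrightarrow>
     (\<forall>t>0. l t > 0) \<and> continuous_on {0<..} l \<and> slowly_varying l"

end

theory Submission
  imports Defs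
begin

text \<open>
  Write \<open>F(m) = - ln \<eta>\<^sup>(\<^sup>2\<^sup>m\<^sup>)(e)\<close> for the cost of asking a lamp to be switched off after \<open>2 m\<close> independent
  moves. The walk on the wreath product returns to the identity in \<open>n\<close> steps with at least the
  probability that the base walk returns while staying in a finite set \<open>B\<close>, times the smallest
  conditional probability that all lamps are then off.

  The lamps: given the base path, different lamps are independent, and the lamp at \<open>z\<close> is a product of as many
  \<open>\<eta>\<close>-moves as there are arrivals at and departures from \<open>z\<close>. On a closed path this number is even,
  namely \<open>2 m(z)\<close> with \<open>m(z)\<close> the number of visits, so the conditional probability is
  \<open>exp (- \<Sum>\<^sub>z F(m(z)))\<close> (lemmas \<open>conv_power_switch_walk_switch\<close>, \<open>pmf_switches\<close>). As \<open>F\<close> is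
  nondecreasing and subadditive, \<open>F(m) \<le> (m / a + 1) F(a)\<close> for every \<open>a \<ge> 1\<close>, and \<open>\<Sum>\<^sub>z m(z) = n\<close>; so
  the sum is at most \<open>(n / a + |B|) F(a)\<close>, whatever the distribution of the visits over \<open>B\<close>
  (\<open>prod_return_prob_ge\<close>). This gives \<open>return_switch_walk_switch_ge\<close>.

  The base walk: take for \<open>B\<close> the ball of radius \<open>\<gamma>\<^sub>2 \<gamma>\<^sub>1 r(b)\<close>. By the confinement estimate in the definition of strong control, each
  block of \<open>b\<close> steps keeps the walk in \<open>B\<close> and brings it back to the ball of radius \<open>\<gamma>\<^sub>1 r(b)\<close> with
  probability at least \<open>\<epsilon>\<close>; hence it stays in \<open>B\<close> for \<open>k\<close> steps with probability at least
  \<open>\<epsilon>\<close> to the power \<open>k / b + 1\<close>. The walk killed outside \<open>B\<close> has a symmetric transition matrix, so by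
  the Cauchy-Schwarz inequality the probability of staying for \<open>2 k\<close> steps and returning is at least the square of
  this, divided by \<open>|B|\<close> (\<open>confined_return_ge\<close>).

  Altogether, up to constants, the exponent is at most \<open>n / b + ln |B| + (n / a + |B|) F(a)\<close>, where \<open>|B|\<close> is at most
  of order \<open>r(b)\<^sup>D\<close>. It remains to optimise: \<open>a\<close> should be of order \<open>n / |B|\<close>, and \<open>b\<close> should balance \<open>n / b\<close> against
  \<open>|B| F(n / |B|)\<close>. With \<open>r(b) = b powr (1/\<beta>) l\<^sub>1(b)\<close> and \<open>F(a)\<close> of order \<open>a powr \<gamma> l\<^sub>2(a)\<close>, both terms
  are then of the order of the exponent in the theorem (\<open>optimal_scales\<close>), provided that \<open>l\<^sub>1(b)\<close> and
  \<open>l\<^sub>2(a)\<close> may be replaced by \<open>l\<^sub>1(n)\<close> and \<open>l\<^sub>2(n)\<close>. The scales \<open>a\<close> and \<open>b\<close> are not exact powers of \<open>n\<close>, so this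
  needs the comparison of \<open>l(t powr c)\<close> with \<open>l(t)\<close> uniformly for \<open>c\<close> in compact sets, which follows from the
  pointwise comparison by Baire's theorem (\<open>increment_bounded_uniformly\<close>,
  \<open>comparable_between_powers\<close>).
\<close>

section \<open>Convolution powers and return probabilities\<close>

lemma set_conv_pmf:
  assumes "group G" "set_pmf p \<subseteq> carrier G" "set_pmf q \<subseteq> carrier G"
  shows "set_pmf (conv_pmf G p q) \<subseteq> carrier G"
proof -
  interpret group G by fact
  show ?thesis using assms by (auto simp: conv_pmf_def)
qed

lemma set_conv_power:
  assumes "group G" "set_pmf p \<subseteq> carrier G"
  shows "set_pmf (conv_power G p n) \<subseteq> carrier G"
proof -
  interpret group G by fact
  show ?thesis
  proof (induction n)
    case (Suc n)
    show ?case using set_conv_pmf[OF assms(1) Suc assms(2)] by simp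
  qed simp
qed

lemma conv_pmf_eq_bind: "conv_pmf G p q = bind_pmf p (\<lambda>x. map_pmf (\<lambda>y. x \<otimes>\<^bsub>G\<^esub> y) q)"
  by (simp add: conv_pmf_def pair_pmf_def map_bind_pmf map_pmf_def bind_assoc_pmf bind_return_pmf)

lemma conv_pmf_eq_bind': "conv_pmf G p q = bind_pmf q (\<lambda>y. map_pmf (\<lambda>x. x \<otimes>\<^bsub>G\<^esub> y) p)"
  unfolding conv_pmf_eq_bind map_pmf_def by (rule bind_commute_pmf)

lemma conv_pmf_assoc:
  assumes "group G" "set_pmf p \<subseteq> carrier G" "set_pmf q \<subseteq> carrier G" "set_pmf s \<subseteq> carrier G"
  shows "conv_pmf G (conv_pmf G p q) s = conv_pmf G p (conv_pmf G q s)"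
proof -
  interpret group G by fact
  show ?thesis
    unfolding conv_pmf_eq_bind map_pmf_def bind_assoc_pmf bind_return_pmf
    by (intro bind_pmf_cong refl) (use assms in \<open>auto simp: m_assoc subset_iff\<close>)
qed

lemma conv_power_add:
  assumes "group G" "set_pmf p \<subseteq> carrier G"
  shows "conv_power G p (m + n) = conv_pmf G (conv_power G p m) (conv_power G p n)"
proof (induction n)
  case 0
  interpret group G by fact
  have "map_pmf (\<lambda>x. x \<otimes>\<^bsub>G\<^esub> \<one>\<^bsub>G\<^esub>) (conv_power G p m) = map_pmf (\<lambda>x. x) (conv_power G p m)"
    by (rule map_pmf_cong) (use set_conv_power[OF assms, of m] in auto)
  then show ?case by (simp add: conv_pmf_eq_bind' bind_return_pmf)
next
  case (Suc n)
  then show ?case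
    using conv_pmf_assoc[OF assms(1) set_conv_power[OF assms] set_conv_power[OF assms] assms(2)]
    by simp
qed

lemma conv_power_1:
  assumes "group G" "set_pmf p \<subseteq> carrier G"
  shows "conv_power G p (Suc 0) = p"
proof -
  interpret group G by fact
  have "map_pmf (\<lambda>x. \<one>\<^bsub>G\<^esub> \<otimes>\<^bsub>G\<^esub> x) p = map_pmf (\<lambda>x. x) p"
    by (rule map_pmf_cong) (use assms in auto)
  then show ?thesis by (simp add: conv_pmf_eq_bind bind_return_pmf)
qed

lemma conv_power_Suc_left:
  assumes "group G" "set_pmf p \<subseteq> carrier G"
  shows "conv_power G p (Suc n) = conv_pmf G p (conv_power G p n)"
  using conv_power_add[OF assms, of "Suc 0" n] conv_power_1[OF assms] by simp

lemma pmf_map_mult_left: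
  assumes "group G" "set_pmf q \<subseteq> carrier G" "x \<in> carrier G" "g \<in> carrier G"
  shows "pmf (map_pmf (\<lambda>y. x \<otimes>\<^bsub>G\<^esub> y) q) g = pmf q (inv\<^bsub>G\<^esub> x \<otimes>\<^bsub>G\<^esub> g)"
proof -
  interpret group G by fact
  have "pmf (map_pmf (\<lambda>y. x \<otimes>\<^bsub>G\<^esub> y) q) g = measure q {y. x \<otimes>\<^bsub>G\<^esub> y = g}"
    by (simp add: pmf_map vimage_def)
  also have "\<dots> = measure q {inv\<^bsub>G\<^esub> x \<otimes>\<^bsub>G\<^esub> g}"
  proof (rule measure_prob_cong_0)
    fix y assume "y \<in> {y. x \<otimes>\<^bsub>G\<^esub> y = g} - {inv\<^bsub>G\<^esub> x \<otimes>\<^bsub>G\<^esub> g}"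
    then have "y \<notin> carrier G" using assms by (auto simp: inv_solve_left)
    then show "pmf q y = 0" using assms by (auto simp: pmf_eq_0_set_pmf)
  next
    fix y assume "y \<in> {inv\<^bsub>G\<^esub> x \<otimes>\<^bsub>G\<^esub> g} - {y. x \<otimes>\<^bsub>G\<^esub> y = g}"
    then have False using assms by (auto simp: m_assoc[symmetric])
    then show "pmf q y = 0" ..
  qed
  finally show ?thesis by (simp add: measure_pmf_single)
qed

lemma pmf_conv_pmf:
  assumes "group G" "set_pmf p \<subseteq> carrier G" "set_pmf q \<subseteq> carrier G" "g \<in> carrier G"
  shows "pmf (conv_pmf G p q) g = (\<integral>x. pmf q (inv\<^bsub>G\<^esub> x \<otimes>\<^bsub>G\<^esub> g) \<partial>measure_pmf p)"
  unfolding conv_pmf_eq_bind pmf_bind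
  by (intro integral_cong_AE)
     (use assms in \<open>auto simp: AE_measure_pmf_iff pmf_map_mult_left subset_iff\<close>)

lemma pmf_conv_pmf_ge: "pmf p x * pmf q y \<le> pmf (conv_pmf G p q) (x \<otimes>\<^bsub>G\<^esub> y)"
proof -
  have "pmf p x * pmf q y = measure (pair_pmf p q) {(x, y)}"
    by (simp add: measure_pmf_single pmf_pair)
  also have "\<dots> \<le> measure (pair_pmf p q) ((\<lambda>(x, y). x \<otimes>\<^bsub>G\<^esub> y) -` {x \<otimes>\<^bsub>G\<^esub> y})"
    by (intro measure_pmf.finite_measure_mono) auto
  finally show ?thesis by (simp add: conv_pmf_def pmf_map)
qed

lemma pmf_conv_power_one_ge:
  assumes "group G"
  shows "pmf p \<one>\<^bsub>G\<^esub> ^ n \<le> pmf (conv_power G p n) \<one>\<^bsub>G\<^esub>"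
proof (induction n)
  case (Suc n)
  interpret group G by fact
  have "pmf p \<one>\<^bsub>G\<^esub> ^ Suc n \<le> pmf (conv_power G p n) \<one>\<^bsub>G\<^esub> * pmf p \<one>\<^bsub>G\<^esub>"
    using Suc by (simp add: mult.commute mult_left_mono)
  also have "\<dots> \<le> pmf (conv_power G p (Suc n)) \<one>\<^bsub>G\<^esub>"
    using pmf_conv_pmf_ge[of "conv_power G p n" "\<one>\<^bsub>G\<^esub>" p "\<one>\<^bsub>G\<^esub>" G] by simp
  finally show ?case .
qed simp

text \<open>
  Inversion maps \<open>p\<close> to itself and reverses products, and all factors of a convolution power are
  the same, so the reversed product has the same law.
\<close>

lemma pmf_conv_power_symmetric:
  assumes "group G" "symmetric_pmf G p" "g \<in> carrier G"
  shows "pmf (conv_power G p n) (inv\<^bsub>G\<^esub> g) = pmf (conv_power G p n) g"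
proof -
  interpret group G by fact
  have sp: "set_pmf p \<subseteq> carrier G" using assms by (auto simp: symmetric_pmf_def)
  have inv_p: "map_pmf (m_inv G) p = p"
  proof (rule pmf_eqI)
    fix x
    show "pmf (map_pmf (m_inv G) p) x = pmf p x"
    proof (cases "x \<in> carrier G")
      case True
      have "pmf (map_pmf (m_inv G) p) x = measure p {y. inv\<^bsub>G\<^esub> y = x}"
        by (simp add: pmf_map vimage_def)
      also have "\<dots> = measure p {inv\<^bsub>G\<^esub> x}"
        by (rule measure_prob_cong_0) (use sp True in \<open>auto simp: pmf_eq_0_set_pmf\<close>)
      finally show ?thesis using assms(2) True unfolding measure_pmf_single symmetric_pmf_def by metis
    next
      case False
      then have "x \<notin> set_pmf p" "x \<notin> m_inv G ` set_pmf p" using sp by auto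
      then show ?thesis by (simp add: pmf_map_outside pmf_eq_0_set_pmf)
    qed
  qed
  have "map_pmf (m_inv G) (conv_power G p n) = conv_power G p n"
  proof (induction n)
    case (Suc n)
    have "map_pmf (m_inv G) (conv_power G p (Suc n))
        = bind_pmf (conv_power G p n) (\<lambda>x. bind_pmf p (\<lambda>y. return_pmf (inv\<^bsub>G\<^esub> (x \<otimes>\<^bsub>G\<^esub> y))))"
      by (simp add: conv_pmf_eq_bind map_bind_pmf map_pmf_def bind_assoc_pmf bind_return_pmf)
    also have "\<dots> = bind_pmf (conv_power G p n) (\<lambda>x. bind_pmf p (\<lambda>y. return_pmf (inv\<^bsub>G\<^esub> y \<otimes>\<^bsub>G\<^esub> inv\<^bsub>G\<^esub> x)))"
      by (intro bind_pmf_cong refl)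
         (use sp set_conv_power[OF assms(1) sp] in \<open>auto simp: inv_mult_group subset_iff\<close>)
    also have "\<dots> = conv_pmf G (map_pmf (m_inv G) p) (map_pmf (m_inv G) (conv_power G p n))"
      by (simp add: conv_pmf_eq_bind' map_pmf_def bind_assoc_pmf bind_return_pmf)
    also have "\<dots> = conv_power G p (Suc n)"
      by (simp add: Suc inv_p conv_power_Suc_left[OF assms(1) sp] del: conv_power.simps)
    finally show ?case .
  qed simp
  then have "pmf (conv_power G p n) (inv\<^bsub>G\<^esub> g)
      = pmf (map_pmf (m_inv G) (conv_power G p n)) (inv\<^bsub>G\<^esub> g)" by simp
  also have "\<dots> = measure (conv_power G p n) {y. inv\<^bsub>G\<^esub> y = inv\<^bsub>G\<^esub> g}"
    by (simp add: pmf_map vimage_def)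
  also have "\<dots> = measure (conv_power G p n) {g}"
    by (rule measure_prob_cong_0)
       (use set_conv_power[OF assms(1) sp] assms(3) inv_inj in \<open>auto simp: pmf_eq_0_set_pmf dest: inj_onD\<close>)
  finally show ?thesis by (simp add: measure_pmf_single)
qed

text \<open>
  Let \<open>u\<close> be the \<open>n\<close>-fold power. The value at \<open>g\<close> is \<open>\<Sum>\<^sub>x u(x) u(x\<inverse> g)\<close>, which by
  \<open>2 s t \<le> s\<^sup>2 + t\<^sup>2\<close> is at most \<open>\<Sum>\<^sub>x u(x)\<^sup>2\<close>, and by symmetry of \<open>u\<close> this is the value at the identity.
\<close>

lemma pmf_conv_power_even_le:
  assumes "group G" "symmetric_pmf G p" "g \<in> carrier G"
  shows "pmf (conv_power G p (2 * n)) g \<le> pmf (conv_power G p (2 * n)) \<one>\<^bsub>G\<^esub>"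
proof -
  interpret group G by fact
  have sp: "set_pmf p \<subseteq> carrier G" using assms by (auto simp: symmetric_pmf_def)
  define u where "u = conv_power G p n"
  have su: "set_pmf u \<subseteq> carrier G" unfolding u_def by (rule set_conv_power[OF assms(1) sp])
  have conv: "ennreal (pmf (conv_power G p (2 * n)) h)
      = (\<integral>\<^sup>+x. ennreal (pmf u x * pmf u (inv\<^bsub>G\<^esub> x \<otimes>\<^bsub>G\<^esub> h)) \<partial>count_space (carrier G))"
    if h: "h \<in> carrier G" for h
  proof -
    have "ennreal (pmf (conv_power G p (2 * n)) h)
        = ennreal (\<integral>x. pmf u (inv\<^bsub>G\<^esub> x \<otimes>\<^bsub>G\<^esub> h) \<partial>measure_pmf u)"
      by (simp add: mult_2 conv_power_add[OF assms(1) sp] pmf_conv_pmf[OF assms(1) su su h] flip: u_def)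
    also have "\<dots> = (\<integral>\<^sup>+x. ennreal (pmf u (inv\<^bsub>G\<^esub> x \<otimes>\<^bsub>G\<^esub> h)) \<partial>measure_pmf u)"
      by (intro nn_integral_eq_integral[symmetric] measure_pmf.integrable_const_bound[where B=1])
         (auto simp: pmf_le_1)
    also have "\<dots> = (\<integral>\<^sup>+x. ennreal (pmf u x * pmf u (inv\<^bsub>G\<^esub> x \<otimes>\<^bsub>G\<^esub> h)) \<partial>count_space UNIV)"
      by (simp add: nn_integral_measure_pmf ennreal_mult)
    also have "\<dots> = (\<integral>\<^sup>+x. ennreal (pmf u x * pmf u (inv\<^bsub>G\<^esub> x \<otimes>\<^bsub>G\<^esub> h)) \<partial>count_space (carrier G))"
      by (subst (2) nn_integral_count_space_indicator, simp, intro nn_integral_cong)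
         (use su in \<open>auto simp: indicator_def pmf_eq_0_set_pmf\<close>)
    finally show ?thesis .
  qed
  have sym: "pmf u (inv\<^bsub>G\<^esub> x) = pmf u x" if "x \<in> carrier G" for x
    unfolding u_def by (rule pmf_conv_power_symmetric[OF assms(1,2) that])
  define S where "S = (\<integral>\<^sup>+x. ennreal ((pmf u x)\<^sup>2) \<partial>count_space (carrier G))"
  have at_one: "ennreal (pmf (conv_power G p (2 * n)) \<one>\<^bsub>G\<^esub>) = S"
    unfolding conv[OF one_closed] S_def
    by (intro nn_integral_cong) (simp add: sym power2_eq_square)
  have bij: "bij_betw (\<lambda>x. inv\<^bsub>G\<^esub> x \<otimes>\<^bsub>G\<^esub> g) (carrier G) (carrier G)"
    by (rule bij_betw_byWitness[where f'="\<lambda>y. g \<otimes>\<^bsub>G\<^esub> inv\<^bsub>G\<^esub> y"])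
       (use assms(3) in \<open>auto simp: inv_mult_group m_assoc[symmetric] r_inv\<close>, simp add: m_assoc)
  have "2 * ennreal (pmf (conv_power G p (2 * n)) g)
      = (\<integral>\<^sup>+x. ennreal (2 * (pmf u x * pmf u (inv\<^bsub>G\<^esub> x \<otimes>\<^bsub>G\<^esub> g))) \<partial>count_space (carrier G))"
    unfolding conv[OF assms(3)] by (simp add: nn_integral_cmult[symmetric] ennreal_mult)
  also have "\<dots> \<le> (\<integral>\<^sup>+x. ennreal ((pmf u x)\<^sup>2) + ennreal ((pmf u (inv\<^bsub>G\<^esub> x \<otimes>\<^bsub>G\<^esub> g))\<^sup>2) \<partial>count_space (carrier G))"
    using sum_squares_bound
    by (intro nn_integral_mono) (auto simp: mult.assoc ennreal_plus[symmetric] simp del: ennreal_plus intro!: ennreal_leI)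
  also have "\<dots> = S + S"
    using nn_integral_bij_count_space[OF bij, of "\<lambda>y. ennreal ((pmf u y)\<^sup>2)"]
    by (simp add: nn_integral_add S_def)
  also have "\<dots> = 2 * ennreal (pmf (conv_power G p (2 * n)) \<one>\<^bsub>G\<^esub>)"
    unfolding at_one by (rule mult_2[symmetric])
  finally have "ennreal (2 * pmf (conv_power G p (2 * n)) g)
      \<le> ennreal (2 * pmf (conv_power G p (2 * n)) \<one>\<^bsub>G\<^esub>)"
    by (simp add: ennreal_mult)
  then show ?thesis
    by (subst (asm) ennreal_le_iff) auto
qed

text \<open>
  Splitting off the first \<open>2 (n - m)\<close> steps makes the left-hand side an average of values of the \<open>2 m\<close>-fold
  power, whose maximum is at the identity.
\<close>

lemma pmf_conv_power_even_antimono: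
  assumes "group G" "symmetric_pmf G p" "m \<le> n"
  shows "pmf (conv_power G p (2 * n)) \<one>\<^bsub>G\<^esub> \<le> pmf (conv_power G p (2 * m)) \<one>\<^bsub>G\<^esub>"
proof -
  interpret group G by fact
  have sp: "set_pmf p \<subseteq> carrier G" using assms by (auto simp: symmetric_pmf_def)
  let ?u = "conv_power G p (2 * (n - m))" and ?v = "conv_power G p (2 * m)"
  have su: "set_pmf ?u \<subseteq> carrier G" and sv: "set_pmf ?v \<subseteq> carrier G"
    using set_conv_power[OF assms(1) sp] by auto
  have "2 * n = 2 * (n - m) + 2 * m" using assms(3) by simp
  then have "pmf (conv_power G p (2 * n)) \<one>\<^bsub>G\<^esub> = (\<integral>x. pmf ?v (inv\<^bsub>G\<^esub> x \<otimes>\<^bsub>G\<^esub> \<one>\<^bsub>G\<^esub>) \<partial>measure_pmf ?u)"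
    by (simp only: conv_power_add[OF assms(1) sp] pmf_conv_pmf[OF assms(1) su sv one_closed])
  also have "\<dots> \<le> (\<integral>x. pmf ?v \<one>\<^bsub>G\<^esub> \<partial>measure_pmf ?u)"
    by (intro integral_mono_AE measure_pmf.integrable_const_bound[where B=1])
       (use su pmf_conv_power_even_le[OF assms(1,2)] in
         \<open>auto simp: pmf_le_1 AE_measure_pmf_iff subset_iff\<close>)
  also have "\<dots> = pmf ?v \<one>\<^bsub>G\<^esub>" by simp
  finally show ?thesis .
qed

text \<open>
  Only even times enter, because the return probabilities of a symmetric walk are nonincreasing along them,
  while at odd times they may vanish.
\<close>

definition return_cost :: "('a, 'b) monoid_scheme \<Rightarrow> 'a pmf \<Rightarrow> nat \<Rightarrow> real" where
  "return_cost G p n = - ln (pmf (conv_power G p (2 * n)) \<one>\<^bsub>G\<^esub>)"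

context
  fixes G :: "('a, 'b) monoid_scheme" and p :: "'a pmf"
  assumes G: "group G" and sym: "symmetric_pmf G p" and pos: "pmf p \<one>\<^bsub>G\<^esub> > 0"
begin

lemma pmf_conv_power_one_pos: "pmf (conv_power G p n) \<one>\<^bsub>G\<^esub> > 0"
  using pmf_conv_power_one_ge[OF G, of p n] pos by (meson less_le_trans zero_less_power)

lemma return_cost_0: "return_cost G p 0 = 0"
  by (simp add: return_cost_def)

lemma return_cost_mono: "m \<le> n \<Longrightarrow> return_cost G p m \<le> return_cost G p n"
  using pmf_conv_power_even_antimono[OF G sym, of m n] pmf_conv_power_one_pos
  by (simp add: return_cost_def)

lemma return_cost_nonneg: "0 \<le> return_cost G p n"
  using return_cost_mono[of 0 n] return_cost_0 by simp

lemma return_cost_add: "return_cost G p (m + n) \<le> return_cost G p m + return_cost G p n"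
proof -
  interpret group G by (rule G)
  have sp: "set_pmf p \<subseteq> carrier G" using sym by (auto simp: symmetric_pmf_def)
  have "pmf (conv_power G p (2 * m)) \<one>\<^bsub>G\<^esub> * pmf (conv_power G p (2 * n)) \<one>\<^bsub>G\<^esub>
      \<le> pmf (conv_power G p (2 * (m + n))) \<one>\<^bsub>G\<^esub>"
    using pmf_conv_pmf_ge[of "conv_power G p (2 * m)" "\<one>\<^bsub>G\<^esub>" "conv_power G p (2 * n)" "\<one>\<^bsub>G\<^esub>" G]
    by (simp add: conv_power_add[OF G sp] distrib_left)
  then have "ln (pmf (conv_power G p (2 * m)) \<one>\<^bsub>G\<^esub> * pmf (conv_power G p (2 * n)) \<one>\<^bsub>G\<^esub>)
      \<le> ln (pmf (conv_power G p (2 * (m + n))) \<one>\<^bsub>G\<^esub>)"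
    using pmf_conv_power_one_pos by (intro ln_mono) auto
  then show ?thesis
    using pmf_conv_power_one_pos by (simp add: return_cost_def ln_mult_pos)
qed

lemma return_cost_mult: "return_cost G p (k * a) \<le> real k * return_cost G p a"
proof (induction k)
  case (Suc k)
  then show ?case using return_cost_add[of a "k * a"] by (simp add: algebra_simps)
qed (simp add: return_cost_0)

text \<open>
  Write \<open>m\<close> as \<open>m div a\<close> blocks of length \<open>a\<close> and a remainder shorter than \<open>a\<close>: subadditivity handles the
  blocks, monotonicity the remainder.
\<close>

lemma return_cost_le_linear:
  assumes "a \<ge> 1"
  shows "return_cost G p m \<le> (real m / real a + 1) * return_cost G p a"
proof -
  have "return_cost G p m = return_cost G p ((m div a) * a + m mod a)" by simp
  also have "\<dots> \<le> real (m div a) * return_cost G p a + return_cost G p (m mod a)"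
    using return_cost_add return_cost_mult by (meson add_right_mono order_trans)
  also have "\<dots> \<le> real (m div a) * return_cost G p a + return_cost G p a"
    using assms by (auto intro!: return_cost_mono simp: less_imp_le)
  also have "\<dots> \<le> (real m / real a + 1) * return_cost G p a"
    using mult_right_mono[OF of_nat_div_le_of_nat[of m a, where ?'a = real] return_cost_nonneg[of a]]
    by (simp add: distrib_right)
  finally show ?thesis .
qed

text \<open>
  The bound depends on the numbers \<open>m z\<close> only through their sum, so it is insensitive to how a walk distributes
  its visits over \<open>B\<close>.
\<close>

lemma prod_return_prob_ge:
  assumes "a \<ge> 1" "finite B"
  shows "(\<Prod>z\<in>B. pmf (conv_power G p (2 * m z)) \<one>\<^bsub>G\<^esub>)
    \<ge> exp (- (real (\<Sum>z\<in>B. m z) / real a + real (card B)) * return_cost G p a)"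
proof -
  let ?r = "(real (\<Sum>z\<in>B. m z) / real a + real (card B)) * return_cost G p a"
  have "(\<Prod>z\<in>B. pmf (conv_power G p (2 * m z)) \<one>\<^bsub>G\<^esub>) = exp (- (\<Sum>z\<in>B. return_cost G p (m z)))"
    using assms(2) pmf_conv_power_one_pos by (simp add: exp_sum return_cost_def flip: sum_negf)
  also have "\<dots> \<ge> exp (- ?r)"
  proof -
    have "(\<Sum>z\<in>B. return_cost G p (m z)) \<le> (\<Sum>z\<in>B. (real (m z) / real a + 1) * return_cost G p a)"
      using return_cost_le_linear[OF assms(1)] by (intro sum_mono)
    also have "\<dots> = ?r"
      by (simp add: sum_distrib_right[symmetric] sum.distrib sum_divide_distrib)
    finally show ?thesis by simp
  qed
  finally show ?thesis by (simp only: mult_minus_left)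
qed

end

section \<open>Walks confined to a finite set\<close>

text \<open>
  The positions \<open>X\<^sub>0, \<dots>, X\<^sub>n\<^sub>-\<^sub>1\<close> of the walk, the final position \<open>X\<^sub>n\<close> being left out: a closed path then
  lists its base point once per visit, and the list has as many entries as there are steps.
\<close>

primrec departures :: "('a, 'b) monoid_scheme \<Rightarrow> 'a \<Rightarrow> 'a list \<Rightarrow> 'a list" where
  "departures G x [] = []"
| "departures G x (s # \<xi>s) = x # departures G (x \<otimes>\<^bsub>G\<^esub> s) \<xi>s"

text \<open>
  Since only departures are tested, the end point \<open>y\<close> may lie outside \<open>B\<close>. For \<open>x\<close> and \<open>y\<close> in \<open>B\<close> this is
  the entry at \<open>(x, y)\<close> of the \<open>n\<close>-th power of the transition matrix of the walk killed outside \<open>B\<close>.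
\<close>

definition confined_prob ::
  "('a, 'b) monoid_scheme \<Rightarrow> 'a pmf \<Rightarrow> 'a set \<Rightarrow> nat \<Rightarrow> 'a \<Rightarrow> 'a \<Rightarrow> real" where
  "confined_prob G \<mu> B n x y = measure_pmf.prob (replicate_pmf n \<mu>)
     {\<xi>s. set (departures G x \<xi>s) \<subseteq> B \<and> foldl (\<otimes>\<^bsub>G\<^esub>) x \<xi>s = y}"

lemma length_departures [simp]: "length (departures G x \<xi>s) = length \<xi>s"
  by (induction \<xi>s arbitrary: x) auto

lemma departures_subset_walk_at:
  "set (departures G x \<xi>s) \<subseteq> walk_at G x \<xi>s ` {0..length \<xi>s}"
proof (induction \<xi>s arbitrary: x)
  case (Cons s \<xi>s)
  have "walk_at G (x \<otimes>\<^bsub>G\<^esub> s) \<xi>s k \<in> walk_at G x (s # \<xi>s) ` {0..length (s # \<xi>s)}"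
    if "k \<le> length \<xi>s" for k
    by (rule image_eqI[of _ _ "Suc k"]) (use that in \<open>auto simp: walk_at_def\<close>)
  moreover have "x \<in> walk_at G x (s # \<xi>s) ` {0..length (s # \<xi>s)}"
    by (rule image_eqI[of _ _ 0]) (auto simp: walk_at_def)
  ultimately show ?case using Cons by fastforce
qed simp

lemma confined_prob_eq_pmf:
  "confined_prob G \<mu> B n x y =
    pmf (map_pmf (\<lambda>\<xi>s. (set (departures G x \<xi>s) \<subseteq> B, foldl (\<otimes>\<^bsub>G\<^esub>) x \<xi>s)) (replicate_pmf n \<mu>)) (True, y)"
  by (simp add: confined_prob_def pmf_map vimage_def)

lemma confined_prob_nonneg [simp]: "0 \<le> confined_prob G \<mu> B n x y"
  by (simp add: confined_prob_def)

lemma confined_prob_0: "confined_prob G \<mu> B 0 x y = of_bool (x = y)"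
  by (simp add: confined_prob_eq_pmf indicator_def)

lemma confined_prob_eq_0:
  assumes "x \<notin> B" "y \<in> B"
  shows "confined_prob G \<mu> B n x y = 0"
proof -
  have "confined_prob G \<mu> B n x y = measure_pmf.prob (replicate_pmf n \<mu>) {}"
    unfolding confined_prob_def
  proof (rule measure_prob_cong_0)
    fix \<xi>s assume "\<xi>s \<in> {\<xi>s. set (departures G x \<xi>s) \<subseteq> B \<and> foldl (\<otimes>\<^bsub>G\<^esub>) x \<xi>s = y} - {}"
    then have False using assms by (cases \<xi>s) auto
    then show "pmf (replicate_pmf n \<mu>) \<xi>s = 0" ..
  qed simp
  then show ?thesis by simp
qed

lemma sum_confined_prob:
  assumes "finite B'"
  shows "(\<Sum>y\<in>B'. confined_prob G \<mu> B n x y) = measure_pmf.prob (replicate_pmf n \<mu>)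
    {\<xi>s. set (departures G x \<xi>s) \<subseteq> B \<and> foldl (\<otimes>\<^bsub>G\<^esub>) x \<xi>s \<in> B'}"
proof -
  let ?h = "\<lambda>\<xi>s. (set (departures G x \<xi>s) \<subseteq> B, foldl (\<otimes>\<^bsub>G\<^esub>) x \<xi>s)"
  let ?p = "map_pmf ?h (replicate_pmf n \<mu>)"
  have "(\<Sum>y\<in>B'. confined_prob G \<mu> B n x y) = (\<Sum>u\<in>Pair True ` B'. pmf ?p u)"
    by (subst sum.reindex) (auto simp: confined_prob_eq_pmf inj_on_def)
  also have "\<dots> = measure_pmf.prob ?p (Pair True ` B')"
    using assms by (intro measure_measure_pmf_finite[symmetric]) auto
  also have "\<dots> = measure_pmf.prob (replicate_pmf n \<mu>) (?h -` (Pair True ` B'))"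
    by simp
  also have "?h -` (Pair True ` B') = {\<xi>s. set (departures G x \<xi>s) \<subseteq> B \<and> foldl (\<otimes>\<^bsub>G\<^esub>) x \<xi>s \<in> B'}"
    by auto
  finally show ?thesis .
qed

context
  fixes G :: "('a, 'b) monoid_scheme" and \<mu> :: "'a pmf" and B :: "'a set"
  assumes G: "group G" and sym: "symmetric_pmf G \<mu>" and B: "finite B" "B \<subseteq> carrier G"
begin

lemma confined_prob_Suc:
  assumes "x \<in> B" "y \<in> B"
  shows "confined_prob G \<mu> B (Suc n) x y =
    (\<Sum>z\<in>B. pmf \<mu> (inv\<^bsub>G\<^esub> x \<otimes>\<^bsub>G\<^esub> z) * confined_prob G \<mu> B n z y)"
proof -
  have s\<mu>: "set_pmf \<mu> \<subseteq> carrier G" using sym by (auto simp: symmetric_pmf_def)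
  have "confined_prob G \<mu> B (Suc n) x y = (\<integral>s. confined_prob G \<mu> B n (x \<otimes>\<^bsub>G\<^esub> s) y \<partial>measure_pmf \<mu>)"
    using assms(1)
    by (simp add: confined_prob_eq_pmf map_pmf_def bind_assoc_pmf bind_return_pmf pmf_bind)
  also have "\<dots> = (\<integral>z. confined_prob G \<mu> B n z y \<partial>measure_pmf (map_pmf (\<lambda>s. x \<otimes>\<^bsub>G\<^esub> s) \<mu>))"
    by simp
  also have "\<dots> = (\<Sum>z\<in>B. confined_prob G \<mu> B n z y * pmf (map_pmf (\<lambda>s. x \<otimes>\<^bsub>G\<^esub> s) \<mu>) z)"
    using confined_prob_eq_0[OF _ assms(2)] by (intro integral_measure_pmf_real B(1)) blast
  also have "\<dots> = (\<Sum>z\<in>B. pmf \<mu> (inv\<^bsub>G\<^esub> x \<otimes>\<^bsub>G\<^esub> z) * confined_prob G \<mu> B n z y)"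
    using B(2) assms(1) by (intro sum.cong refl) (auto simp: pmf_map_mult_left[OF G s\<mu>] subset_iff)
  finally show ?thesis .
qed

lemma confined_prob_1:
  assumes "x \<in> B" "y \<in> B"
  shows "confined_prob G \<mu> B (Suc 0) x y = pmf \<mu> (inv\<^bsub>G\<^esub> x \<otimes>\<^bsub>G\<^esub> y)"
  using B(1) assms by (simp add: confined_prob_Suc confined_prob_0 of_bool_def sum.delta if_distrib cong: if_cong)

lemma confined_prob_add:
  assumes "x \<in> B" "y \<in> B"
  shows "confined_prob G \<mu> B (m + n) x y = (\<Sum>z\<in>B. confined_prob G \<mu> B m x z * confined_prob G \<mu> B n z y)"
  using assms(1)
proof (induction m arbitrary: x)
  case 0
  have "(\<Sum>z\<in>B. of_bool (x = z) * confined_prob G \<mu> B n z y)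
      = (\<Sum>z\<in>B. if x = z then confined_prob G \<mu> B n z y else 0)"
    by (intro sum.cong) auto
  then show ?case using B(1) 0 by (simp add: confined_prob_0)
next
  case (Suc m)
  have "confined_prob G \<mu> B (Suc m + n) x y = (\<Sum>w\<in>B. pmf \<mu> (inv\<^bsub>G\<^esub> x \<otimes>\<^bsub>G\<^esub> w) *
      (\<Sum>z\<in>B. confined_prob G \<mu> B m w z * confined_prob G \<mu> B n z y))"
    using Suc assms(2) by (simp add: confined_prob_Suc)
  also have "\<dots> = (\<Sum>w\<in>B. \<Sum>z\<in>B. pmf \<mu> (inv\<^bsub>G\<^esub> x \<otimes>\<^bsub>G\<^esub> w) * confined_prob G \<mu> B m w z * confined_prob G \<mu> B n z y)"
    by (simp add: sum_distrib_left mult.assoc)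
  also have "\<dots> = (\<Sum>z\<in>B. \<Sum>w\<in>B. pmf \<mu> (inv\<^bsub>G\<^esub> x \<otimes>\<^bsub>G\<^esub> w) * confined_prob G \<mu> B m w z * confined_prob G \<mu> B n z y)"
    by (rule sum.swap)
  also have "\<dots> = (\<Sum>z\<in>B. confined_prob G \<mu> B (Suc m) x z * confined_prob G \<mu> B n z y)"
    using Suc by (simp add: confined_prob_Suc sum_distrib_right)
  finally show ?case .
qed

text \<open>
  One step has a symmetric matrix because \<open>\<mu>\<close> is symmetric; peeling a step off at the left of one side
  corresponds, by the Chapman-Kolmogorov equation, to peeling it off at the right of the other.
\<close>

lemma confined_prob_sym:
  assumes "x \<in> B" "y \<in> B"
  shows "confined_prob G \<mu> B n x y = confined_prob G \<mu> B n y x"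
  using assms
proof (induction n arbitrary: x y)
  case 0
  then show ?case by (simp add: confined_prob_0 eq_commute)
next
  case (Suc n)
  interpret group G by (rule G)
  have step: "pmf \<mu> (inv\<^bsub>G\<^esub> x \<otimes>\<^bsub>G\<^esub> z) = confined_prob G \<mu> B (Suc 0) z x" if "z \<in> B" for z
  proof -
    have "x \<in> carrier G" "z \<in> carrier G" using that Suc.prems B by auto
    then have "inv\<^bsub>G\<^esub> (inv\<^bsub>G\<^esub> x \<otimes>\<^bsub>G\<^esub> z) = inv\<^bsub>G\<^esub> z \<otimes>\<^bsub>G\<^esub> x" "inv\<^bsub>G\<^esub> x \<otimes>\<^bsub>G\<^esub> z \<in> carrier G"
      by (auto simp: inv_mult_group)
    then have "pmf \<mu> (inv\<^bsub>G\<^esub> x \<otimes>\<^bsub>G\<^esub> z) = pmf \<mu> (inv\<^bsub>G\<^esub> z \<otimes>\<^bsub>G\<^esub> x)"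
      using sym unfolding symmetric_pmf_def by metis
    then show ?thesis using that Suc.prems by (simp add: confined_prob_1)
  qed
  have "confined_prob G \<mu> B (Suc n) x y
      = (\<Sum>z\<in>B. confined_prob G \<mu> B n y z * confined_prob G \<mu> B (Suc 0) z x)"
    using Suc by (auto simp: confined_prob_Suc[OF Suc.prems] step mult.commute intro!: sum.cong)
  also have "\<dots> = confined_prob G \<mu> B (Suc n) y x"
    using confined_prob_add[OF Suc.prems(2,1), of n "Suc 0"] by simp
  finally show ?case .
qed

lemma sum_confined_prob_antimono:
  assumes "x \<in> B" "m \<le> n"
  shows "(\<Sum>y\<in>B. confined_prob G \<mu> B n x y) \<le> (\<Sum>y\<in>B. confined_prob G \<mu> B m x y)"
proof -
  have "(\<Sum>y\<in>B. confined_prob G \<mu> B n x y)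
      = (\<Sum>y\<in>B. \<Sum>z\<in>B. confined_prob G \<mu> B m x z * confined_prob G \<mu> B (n - m) z y)"
    using confined_prob_add[OF assms(1), of _ m "n - m"] assms(2) by simp
  also have "\<dots> = (\<Sum>z\<in>B. confined_prob G \<mu> B m x z * (\<Sum>y\<in>B. confined_prob G \<mu> B (n - m) z y))"
    by (subst sum.swap) (simp add: sum_distrib_left)
  also have "\<dots> \<le> (\<Sum>z\<in>B. confined_prob G \<mu> B m x z * 1)"
    by (intro sum_mono mult_left_mono) (auto simp: sum_confined_prob[OF B(1)])
  finally show ?thesis by simp
qed

text \<open>
  A walk that is in \<open>B'\<close> at the multiples of \<open>b\<close> and does not leave \<open>B\<close> in between contributes; by the Markov
  property every block costs a factor \<open>\<epsilon>\<close>.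
\<close>

lemma confined_prob_blocks:
  assumes sub: "B' \<subseteq> B" and \<epsilon>: "\<epsilon> \<ge> 0"
    and block: "\<And>x. x \<in> B' \<Longrightarrow> (\<Sum>y\<in>B'. confined_prob G \<mu> B b x y) \<ge> \<epsilon>"
  shows "x \<in> B' \<Longrightarrow> (\<Sum>y\<in>B'. confined_prob G \<mu> B (j * b) x y) \<ge> \<epsilon> ^ j"
proof (induction j arbitrary: x)
  case 0
  then show ?case using finite_subset[OF sub B(1)] by (simp add: confined_prob_0 of_bool_def)
next
  case (Suc j)
  have "\<epsilon> ^ Suc j \<le> (\<Sum>z\<in>B'. confined_prob G \<mu> B b x z) * \<epsilon> ^ j"
    using block[OF Suc.prems] \<epsilon> by (simp add: mult_right_mono)
  also have "\<dots> \<le> (\<Sum>z\<in>B'. confined_prob G \<mu> B b x z * (\<Sum>y\<in>B'. confined_prob G \<mu> B (j * b) z y))"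
    unfolding sum_distrib_right by (intro sum_mono mult_left_mono Suc.IH) auto
  also have "\<dots> \<le> (\<Sum>z\<in>B. confined_prob G \<mu> B b x z * (\<Sum>y\<in>B'. confined_prob G \<mu> B (j * b) z y))"
    using sub B(1) by (intro sum_mono2) (auto intro!: mult_nonneg_nonneg sum_nonneg)
  also have "\<dots> = (\<Sum>y\<in>B'. \<Sum>z\<in>B. confined_prob G \<mu> B b x z * confined_prob G \<mu> B (j * b) z y)"
    by (subst sum.swap) (simp add: sum_distrib_left)
  also have "\<dots> = (\<Sum>y\<in>B'. confined_prob G \<mu> B (Suc j * b) x y)"
    using Suc.prems sub
    by (intro sum.cong refl, simp only: mult_Suc, subst confined_prob_add) auto
  finally show ?case .
qed

text \<open>
  By symmetry, returning after \<open>2 k\<close> steps has probability \<open>\<Sum>\<^sub>y P\<^sub>k(x, y)\<^sup>2\<close>, which the Cauchy-Schwarz inequality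
  bounds below by \<open>(\<Sum>\<^sub>y P\<^sub>k(x, y))\<^sup>2 / |B|\<close>. This turns an estimate for staying in \<open>B\<close> into one for
  returning exactly to the starting point. Stopping at \<open>k\<close> rather than at \<open>j * b\<close> only helps, so \<open>k\<close> need not be a
  multiple of \<open>b\<close>.
\<close>

lemma confined_return_ge:
  assumes sub: "B' \<subseteq> B" and \<epsilon>: "\<epsilon> \<ge> 0"
    and block: "\<And>x. x \<in> B' \<Longrightarrow> (\<Sum>y\<in>B'. confined_prob G \<mu> B b x y) \<ge> \<epsilon>"
    and x: "x \<in> B'" and k: "k \<le> j * b"
  shows "confined_prob G \<mu> B (2 * k) x x \<ge> (\<epsilon> ^ j)\<^sup>2 / real (card B)"
proof -
  have xB: "x \<in> B" using x sub by auto
  have "\<epsilon> ^ j \<le> (\<Sum>y\<in>B'. confined_prob G \<mu> B (j * b) x y)"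
    by (rule confined_prob_blocks[OF sub \<epsilon> block x])
  also have "\<dots> \<le> (\<Sum>y\<in>B. confined_prob G \<mu> B (j * b) x y)"
    using sub B(1) by (intro sum_mono2) auto
  also have "\<dots> \<le> (\<Sum>y\<in>B. confined_prob G \<mu> B k x y)"
    by (rule sum_confined_prob_antimono[OF xB k])
  finally have "(\<epsilon> ^ j)\<^sup>2 \<le> (\<Sum>y\<in>B. confined_prob G \<mu> B k x y)\<^sup>2"
    using \<epsilon> by (intro power_mono) auto
  also have "\<dots> \<le> (\<Sum>y\<in>B. (confined_prob G \<mu> B k x y)\<^sup>2) * real (card B)"
    by (rule sum_squared_le_sum_of_squares)
  also have "(\<Sum>y\<in>B. (confined_prob G \<mu> B k x y)\<^sup>2) = confined_prob G \<mu> B (2 * k) x x"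
    using confined_prob_add[OF xB xB, of k k] confined_prob_sym[OF xB]
    by (simp add: mult_2 power2_eq_square)
  finally show ?thesis
    using B(1) xB by (subst pos_divide_le_eq) (auto simp: card_gt_0_iff)
qed

end

section \<open>Lamp configurations along a walk\<close>

primrec switches :: "('k, 'c) monoid_scheme \<Rightarrow> 'k pmf \<Rightarrow> 'h list \<Rightarrow> ('h \<Rightarrow> 'k) \<Rightarrow> ('h \<Rightarrow> 'k) pmf" where
  "switches K \<eta> [] f = return_pmf f"
| "switches K \<eta> (h # hs) f = bind_pmf \<eta> (\<lambda>k. switches K \<eta> hs (f(h := f h \<otimes>\<^bsub>K\<^esub> k)))"

text \<open>
  A step from \<open>x\<close> to \<open>x s\<close> of the switch-walk-switch walk first moves the lamp at \<open>x\<close>, then the lamp at \<open>x s\<close>.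
\<close>

primrec switch_sites :: "('h, 'd) monoid_scheme \<Rightarrow> 'h \<Rightarrow> 'h list \<Rightarrow> 'h list" where
  "switch_sites H x [] = []"
| "switch_sites H x (s # \<xi>s) = x # (x \<otimes>\<^bsub>H\<^esub> s) # switch_sites H (x \<otimes>\<^bsub>H\<^esub> s) \<xi>s"

text \<open>
  Every visit that is neither the first nor the last position of the path is both an arrival and a departure, hence two
  switches. In particular the counts are even on closed paths, which is what makes return probabilities at even times
  the right quantity for the lamps.
\<close>

lemma count_switch_sites:
  "count_list (switch_sites H x \<xi>s) z + of_bool (z = x) =
    2 * count_list (departures H x \<xi>s) z + of_bool (z = foldl (\<otimes>\<^bsub>H\<^esub>) x \<xi>s)"
proof (induction \<xi>s arbitrary: x)
  case (Cons s \<xi>s)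
  show ?case using Cons[of "x \<otimes>\<^bsub>H\<^esub> s"] by (auto simp: of_bool_def split: if_splits)
qed simp

lemma set_switch_sites:
  "set (switch_sites H x \<xi>s) \<subseteq> insert (foldl (\<otimes>\<^bsub>H\<^esub>) x \<xi>s) (set (departures H x \<xi>s))"
proof (induction \<xi>s arbitrary: x)
  case (Cons s \<xi>s)
  have "x \<otimes>\<^bsub>H\<^esub> s \<in> insert (foldl (\<otimes>\<^bsub>H\<^esub>) (x \<otimes>\<^bsub>H\<^esub> s) \<xi>s) (set (departures H (x \<otimes>\<^bsub>H\<^esub> s) \<xi>s))"
    by (cases \<xi>s) auto
  then show ?case using Cons[of "x \<otimes>\<^bsub>H\<^esub> s"] by auto
qed simp

text \<open>
  The lamps are independent given the list of sites, and the move of the lamp at \<open>z\<close> from \<open>f z\<close> to \<open>g z\<close> is a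
  product of one \<open>\<eta>\<close>-distributed factor per occurrence of \<open>z\<close>. The target \<open>g\<close> is arbitrary rather than
  trivial, and so is \<open>f\<close>, to make the induction go through.
\<close>

lemma pmf_switches:
  assumes K: "group K" and \<eta>: "set_pmf \<eta> \<subseteq> carrier K" and S: "finite S" "set hs \<subseteq> S"
    and f: "\<And>z. z \<in> S \<Longrightarrow> f z \<in> carrier K" and g: "\<And>z. z \<in> S \<Longrightarrow> g z \<in> carrier K"
    and eq: "\<And>z. z \<notin> S \<Longrightarrow> f z = g z"
  shows "pmf (switches K \<eta> hs f) g =
    (\<Prod>z\<in>S. pmf (conv_power K \<eta> (count_list hs z)) (inv\<^bsub>K\<^esub> (f z) \<otimes>\<^bsub>K\<^esub> g z))"
  using S(2) f eq
proof (induction hs arbitrary: f)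
  case Nil
  interpret K: group K by (rule K)
  have *: "pmf (return_pmf \<one>\<^bsub>K\<^esub>) (inv\<^bsub>K\<^esub> (f z) \<otimes>\<^bsub>K\<^esub> g z) = of_bool (f z = g z)" if "z \<in> S" for z
  proof -
    have "f z \<in> carrier K" "g z \<in> carrier K" using that Nil g by auto
    then have "inv\<^bsub>K\<^esub> (f z) \<otimes>\<^bsub>K\<^esub> g z = \<one>\<^bsub>K\<^esub> \<longleftrightarrow> f z = g z"
      by (metis K.inv_closed K.inv_inv K.inv_equality K.l_inv)
    then show ?thesis by (auto simp: indicator_def)
  qed
  show ?case
  proof (cases "f = g")
    case True
    then show ?thesis using * by simp
  next
    case False
    then obtain z where "z \<in> S" "f z \<noteq> g z" using Nil by (metis ext)
    then have "(\<Prod>z\<in>S. pmf (return_pmf \<one>\<^bsub>K\<^esub>) (inv\<^bsub>K\<^esub> (f z) \<otimes>\<^bsub>K\<^esub> g z)) = 0"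
      using S(1) * by (intro prod_zero) auto
    then show ?thesis using False by simp
  qed
next
  case (Cons h hs)
  interpret K: group K by (rule K)
  have h: "h \<in> S" and hs: "set hs \<subseteq> S" using Cons.prems(1) by auto
  have fh: "f h \<in> carrier K" "g h \<in> carrier K" using h Cons.prems(2) g by auto
  define c where "c z = conv_power K \<eta> (count_list hs z)" for z
  define P where "P = (\<Prod>z\<in>S - {h}. pmf (c z) (inv\<^bsub>K\<^esub> (f z) \<otimes>\<^bsub>K\<^esub> g z))"
  have c: "set_pmf (c z) \<subseteq> carrier K" for z
    unfolding c_def by (rule set_conv_power[OF K \<eta>])
  have step: "pmf (switches K \<eta> hs (f(h := f h \<otimes>\<^bsub>K\<^esub> k))) g
      = pmf (c h) (inv\<^bsub>K\<^esub> k \<otimes>\<^bsub>K\<^esub> (inv\<^bsub>K\<^esub> (f h) \<otimes>\<^bsub>K\<^esub> g h)) * P" if "k \<in> carrier K" for k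
  proof -
    let ?f = "f(h := f h \<otimes>\<^bsub>K\<^esub> k)"
    have "pmf (switches K \<eta> hs ?f) g = (\<Prod>z\<in>S. pmf (c z) (inv\<^bsub>K\<^esub> (?f z) \<otimes>\<^bsub>K\<^esub> g z))"
      unfolding c_def using Cons.prems h that fh by (intro Cons.IH hs) auto
    also have "\<dots> = pmf (c h) (inv\<^bsub>K\<^esub> (f h \<otimes>\<^bsub>K\<^esub> k) \<otimes>\<^bsub>K\<^esub> g h) * P"
      unfolding P_def by (subst prod.remove[OF S(1) h]) (auto intro!: prod.cong)
    finally show ?thesis using that fh by (simp add: K.inv_mult_group K.m_assoc)
  qed
  have "pmf (switches K \<eta> (h # hs) f) g
      = (\<integral>k. pmf (c h) (inv\<^bsub>K\<^esub> k \<otimes>\<^bsub>K\<^esub> (inv\<^bsub>K\<^esub> (f h) \<otimes>\<^bsub>K\<^esub> g h)) * P \<partial>measure_pmf \<eta>)"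
    unfolding switches.simps pmf_bind
    by (intro integral_cong_AE) (use \<eta> step in \<open>auto simp: AE_measure_pmf_iff\<close>)
  also have "\<dots> = pmf (conv_pmf K \<eta> (c h)) (inv\<^bsub>K\<^esub> (f h) \<otimes>\<^bsub>K\<^esub> g h) * P"
    using fh by (simp add: pmf_conv_pmf[OF K \<eta> c])
  also have "conv_pmf K \<eta> (c h) = conv_power K \<eta> (count_list (h # hs) h)"
    by (simp add: c_def conv_power_Suc_left[OF K \<eta>] del: conv_power.simps)
  also have "pmf \<dots> (inv\<^bsub>K\<^esub> (f h) \<otimes>\<^bsub>K\<^esub> g h) * P
      = (\<Prod>z\<in>S. pmf (conv_power K \<eta> (count_list (h # hs) z)) (inv\<^bsub>K\<^esub> (f z) \<otimes>\<^bsub>K\<^esub> g z))"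
    unfolding P_def c_def by (subst prod.remove[OF S(1) h]) (auto intro!: prod.cong split: if_splits)
  finally show ?case .
qed

lemma lamp_mult: "f \<otimes>\<^bsub>lamp_group K H\<^esub> g = (\<lambda>i\<in>carrier H. f i \<otimes>\<^bsub>K\<^esub> g i)"
  by (simp add: lamp_group_def)

lemma lamp_one: "\<one>\<^bsub>lamp_group K H\<^esub> = (\<lambda>i\<in>carrier H. \<one>\<^bsub>K\<^esub>)"
  by (simp add: lamp_group_def)

context
  fixes H :: "('h, 'c) monoid_scheme" and K :: "('k, 'd) monoid_scheme"
  assumes H: "group H" and K: "group K"
begin

interpretation H: group H by (rule H)
interpretation K: group K by (rule K)
interpretation W: group "wreath K H" by (rule group_wreath[OF K H])

lemma lamp_update_closed:
  assumes "f \<in> carrier (lamp_group K H)" "h \<in> carrier H" "k \<in> carrier K"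
  shows "f(h := k) \<in> carrier (lamp_group K H)"
proof -
  have "{i \<in> carrier H. (f(h := k)) i \<noteq> \<one>\<^bsub>K\<^esub>} \<subseteq> insert h {i \<in> carrier H. f i \<noteq> \<one>\<^bsub>K\<^esub>}" by auto
  then have "finite {i \<in> carrier H. (f(h := k)) i \<noteq> \<one>\<^bsub>K\<^esub>}"
    using assms(1) by (elim finite_subset) (simp add: carrier_lamp_group[OF K])
  then show ?thesis
    using assms by (auto simp: carrier_lamp_group[OF K] PiE_iff extensional_def)
qed

lemma lamp_embed_closed: "k \<in> carrier K \<Longrightarrow> lamp_embed K H k \<in> carrier (wreath K H)"
  by (auto simp: lamp_embed_def wreath_def carrier_lamp_group[OF K] intro: rev_finite_subset[of "{\<one>\<^bsub>H\<^esub>}"])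

lemma base_embed_closed: "x \<in> carrier H \<Longrightarrow> base_embed K H x \<in> carrier (wreath K H)"
  by (auto simp: base_embed_def wreath_def carrier_lamp_group[OF K])

lemma mult_lamp_embed:
  assumes "(f, h) \<in> carrier (wreath K H)" "k \<in> carrier K"
  shows "(f, h) \<otimes>\<^bsub>wreath K H\<^esub> lamp_embed K H k = (f(h := f h \<otimes>\<^bsub>K\<^esub> k), h)"
proof -
  have f: "f \<in> carrier H \<rightarrow>\<^sub>E carrier K" and h: "h \<in> carrier H"
    using assms by (auto simp: wreath_def carrier_lamp_group[OF K])
  have "inv\<^bsub>H\<^esub> h \<otimes>\<^bsub>H\<^esub> i = \<one>\<^bsub>H\<^esub> \<longleftrightarrow> i = h" if "i \<in> carrier H" for i
    using that h by (metis H.inv_closed H.inv_inv H.inv_equality H.l_inv)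
  then have "f \<otimes>\<^bsub>lamp_group K H\<^esub> translate H h (\<lambda>i\<in>carrier H. if i = \<one>\<^bsub>H\<^esub> then k else \<one>\<^bsub>K\<^esub>)
      = f(h := f h \<otimes>\<^bsub>K\<^esub> k)"
    using f h assms(2) by (auto simp: lamp_mult translate_def fun_eq_iff PiE_iff extensional_def)
  then show ?thesis using h by (simp add: wreath_def lamp_embed_def)
qed

lemma mult_base_embed:
  assumes "(f, h) \<in> carrier (wreath K H)" "x \<in> carrier H"
  shows "(f, h) \<otimes>\<^bsub>wreath K H\<^esub> base_embed K H x = (f, h \<otimes>\<^bsub>H\<^esub> x)"
proof -
  have f: "f \<in> carrier H \<rightarrow>\<^sub>E carrier K" and h: "h \<in> carrier H"
    using assms by (auto simp: wreath_def carrier_lamp_group[OF K])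
  have "f \<otimes>\<^bsub>lamp_group K H\<^esub> translate H h (\<lambda>i\<in>carrier H. \<one>\<^bsub>K\<^esub>) = f"
    using f h assms(2) by (auto simp: lamp_mult translate_def fun_eq_iff PiE_iff extensional_def)
  then show ?thesis using h by (simp add: wreath_def base_embed_def)
qed

context
  fixes \<mu> :: "'h pmf" and \<eta> :: "'k pmf"
  assumes \<mu>: "symmetric_pmf H \<mu>" and \<eta>: "symmetric_pmf K \<eta>"
begin

lemma set_mu: "set_pmf \<mu> \<subseteq> carrier H" and set_eta: "set_pmf \<eta> \<subseteq> carrier K"
  using \<mu> \<eta> by (auto simp: symmetric_pmf_def)

lemma switch_walk_switch_eq:
  "switch_walk_switch K H \<eta> \<mu> = bind_pmf \<eta> (\<lambda>k. bind_pmf \<mu> (\<lambda>x. bind_pmf \<eta> (\<lambda>k'. return_pmf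
     (lamp_embed K H k \<otimes>\<^bsub>wreath K H\<^esub> base_embed K H x \<otimes>\<^bsub>wreath K H\<^esub> lamp_embed K H k'))))"
  unfolding switch_walk_switch_def conv_pmf_eq_bind map_pmf_def bind_assoc_pmf bind_return_pmf ..

lemma set_switch_walk_switch: "set_pmf (switch_walk_switch K H \<eta> \<mu>) \<subseteq> carrier (wreath K H)"
  using set_mu set_eta
  by (auto simp: switch_walk_switch_eq intro!: W.m_closed lamp_embed_closed base_embed_closed)

lemma mult_switch_walk_switch_step:
  assumes fh: "(f, h) \<in> carrier (wreath K H)"
    and k: "k \<in> carrier K" "k' \<in> carrier K" and x: "x \<in> carrier H"
  shows "(f, h) \<otimes>\<^bsub>wreath K H\<^esub>
      (lamp_embed K H k \<otimes>\<^bsub>wreath K H\<^esub> base_embed K H x \<otimes>\<^bsub>wreath K H\<^esub> lamp_embed K H k') =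
    ((f(h := f h \<otimes>\<^bsub>K\<^esub> k))(h \<otimes>\<^bsub>H\<^esub> x := (f(h := f h \<otimes>\<^bsub>K\<^esub> k)) (h \<otimes>\<^bsub>H\<^esub> x) \<otimes>\<^bsub>K\<^esub> k'), h \<otimes>\<^bsub>H\<^esub> x)"
proof -
  note cl = fh lamp_embed_closed[OF k(1)] lamp_embed_closed[OF k(2)] base_embed_closed[OF x]
  have h: "h \<in> carrier H" and f: "f h \<in> carrier K" "f \<in> carrier (lamp_group K H)"
    using fh by (auto simp: wreath_def carrier_lamp_group[OF K])
  have fh': "(f(h := f h \<otimes>\<^bsub>K\<^esub> k), h) \<in> carrier (wreath K H)"
    "(f(h := f h \<otimes>\<^bsub>K\<^esub> k), h \<otimes>\<^bsub>H\<^esub> x) \<in> carrier (wreath K H)"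
    using h f k x by (auto simp: wreath_def intro!: lamp_update_closed)
  have "(f, h) \<otimes>\<^bsub>wreath K H\<^esub>
      (lamp_embed K H k \<otimes>\<^bsub>wreath K H\<^esub> base_embed K H x \<otimes>\<^bsub>wreath K H\<^esub> lamp_embed K H k')
    = (f, h) \<otimes>\<^bsub>wreath K H\<^esub> lamp_embed K H k \<otimes>\<^bsub>wreath K H\<^esub> base_embed K H x \<otimes>\<^bsub>wreath K H\<^esub> lamp_embed K H k'"
    using cl by (simp add: W.m_assoc)
  then show ?thesis
    by (simp only: mult_lamp_embed[OF fh k(1)] mult_base_embed[OF fh'(1) x] mult_lamp_embed[OF fh'(2) k(2)])
qed

text \<open>
  Conditionally on the increments of the base walk, only the lamp moves at the switch sites remain random. The start
  \<open>(f, h)\<close> is arbitrary because the first step changes it; the two lamp moves of that step are then exchanged with the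
  later increments, of which they are independent.
\<close>

lemma conv_power_switch_walk_switch:
  assumes "(f, h) \<in> carrier (wreath K H)"
  shows "map_pmf (\<lambda>y. (f, h) \<otimes>\<^bsub>wreath K H\<^esub> y) (conv_power (wreath K H) (switch_walk_switch K H \<eta> \<mu>) n) =
    bind_pmf (replicate_pmf n \<mu>) (\<lambda>\<xi>s.
      map_pmf (\<lambda>g. (g, foldl (\<otimes>\<^bsub>H\<^esub>) h \<xi>s)) (switches K \<eta> (switch_sites H h \<xi>s) f))"
  using assms
proof (induction n arbitrary: f h)
  case 0
  then show ?case by (simp add: bind_return_pmf)
next
  case (Suc n)
  let ?W = "wreath K H" and ?q = "switch_walk_switch K H \<eta> \<mu>"
  let ?R = "\<lambda>(f, h). bind_pmf (replicate_pmf n \<mu>) (\<lambda>\<xi>s.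
      map_pmf (\<lambda>g. (g, foldl (\<otimes>\<^bsub>H\<^esub>) h \<xi>s)) (switches K \<eta> (switch_sites H h \<xi>s) f))"
  have cp: "set_pmf (conv_power ?W ?q n) \<subseteq> carrier ?W"
    by (rule set_conv_power[OF W.is_group set_switch_walk_switch])
  have IH: "bind_pmf (conv_power ?W ?q n) (\<lambda>y. return_pmf (g \<otimes>\<^bsub>?W\<^esub> y)) = ?R g" if "g \<in> carrier ?W" for g
    using Suc.IH[of "fst g" "snd g"] that by (simp add: map_pmf_def case_prod_beta)
  have "map_pmf (\<lambda>y. (f, h) \<otimes>\<^bsub>?W\<^esub> y) (conv_power ?W ?q (Suc n))
      = bind_pmf ?q (\<lambda>s. bind_pmf (conv_power ?W ?q n) (\<lambda>y. return_pmf ((f, h) \<otimes>\<^bsub>?W\<^esub> (s \<otimes>\<^bsub>?W\<^esub> y))))"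
    unfolding conv_power_Suc_left[OF W.is_group set_switch_walk_switch] conv_pmf_eq_bind
      map_pmf_def bind_assoc_pmf bind_return_pmf ..
  also have "\<dots> = bind_pmf ?q (\<lambda>s. ?R ((f, h) \<otimes>\<^bsub>?W\<^esub> s))"
  proof (intro bind_pmf_cong refl)
    fix s assume s: "s \<in> set_pmf ?q"
    then have sc: "s \<in> carrier ?W" using set_switch_walk_switch by auto
    have "bind_pmf (conv_power ?W ?q n) (\<lambda>y. return_pmf ((f, h) \<otimes>\<^bsub>?W\<^esub> (s \<otimes>\<^bsub>?W\<^esub> y)))
        = bind_pmf (conv_power ?W ?q n) (\<lambda>y. return_pmf ((f, h) \<otimes>\<^bsub>?W\<^esub> s \<otimes>\<^bsub>?W\<^esub> y))"
      using sc Suc.prems cp by (intro bind_pmf_cong refl) (auto simp: W.m_assoc subset_iff)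
    also have "\<dots> = ?R ((f, h) \<otimes>\<^bsub>?W\<^esub> s)" using sc Suc.prems by (intro IH W.m_closed)
    finally show "bind_pmf (conv_power ?W ?q n) (\<lambda>y. return_pmf ((f, h) \<otimes>\<^bsub>?W\<^esub> (s \<otimes>\<^bsub>?W\<^esub> y)))
        = ?R ((f, h) \<otimes>\<^bsub>?W\<^esub> s)" .
  qed
  also have "\<dots> = bind_pmf \<eta> (\<lambda>k. bind_pmf \<mu> (\<lambda>x. bind_pmf \<eta> (\<lambda>k'.
      ?R ((f(h := f h \<otimes>\<^bsub>K\<^esub> k))(h \<otimes>\<^bsub>H\<^esub> x := (f(h := f h \<otimes>\<^bsub>K\<^esub> k)) (h \<otimes>\<^bsub>H\<^esub> x) \<otimes>\<^bsub>K\<^esub> k'), h \<otimes>\<^bsub>H\<^esub> x))))"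
    unfolding switch_walk_switch_eq bind_assoc_pmf bind_return_pmf
    using set_mu set_eta
    by (intro bind_pmf_cong refl arg_cong[where f = ?R] mult_switch_walk_switch_step[OF Suc.prems]) auto
  also have "\<dots> = bind_pmf \<mu> (\<lambda>x. bind_pmf (replicate_pmf n \<mu>) (\<lambda>\<xi>s. bind_pmf \<eta> (\<lambda>k. bind_pmf \<eta> (\<lambda>k'.
      map_pmf (\<lambda>g. (g, foldl (\<otimes>\<^bsub>H\<^esub>) (h \<otimes>\<^bsub>H\<^esub> x) \<xi>s)) (switches K \<eta> (switch_sites H (h \<otimes>\<^bsub>H\<^esub> x) \<xi>s)
        ((f(h := f h \<otimes>\<^bsub>K\<^esub> k))(h \<otimes>\<^bsub>H\<^esub> x := (f(h := f h \<otimes>\<^bsub>K\<^esub> k)) (h \<otimes>\<^bsub>H\<^esub> x) \<otimes>\<^bsub>K\<^esub> k')))))))"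
    unfolding prod.case
    by (subst bind_commute_pmf[of \<eta> \<mu>], intro bind_pmf_cong refl,
        subst bind_commute_pmf[of "replicate_pmf n \<mu>"], intro bind_pmf_cong refl,
        rule bind_commute_pmf)
  also have "\<dots> = bind_pmf (replicate_pmf (Suc n) \<mu>) (\<lambda>\<xi>s.
      map_pmf (\<lambda>g. (g, foldl (\<otimes>\<^bsub>H\<^esub>) h \<xi>s)) (switches K \<eta> (switch_sites H h \<xi>s) f))"
    by (simp add: bind_assoc_pmf bind_return_pmf map_bind_pmf)
  finally show ?case .
qed

text \<open>
  Keep only the paths of the base walk that are closed and confined to \<open>B\<close>: on each of them the probability that all lamps
  end up trivial has the same lower bound.
\<close>

lemma return_switch_walk_switch_ge:
  assumes \<eta>1: "pmf \<eta> \<one>\<^bsub>K\<^esub> > 0" and B: "finite B" "B \<subseteq> carrier H" "\<one>\<^bsub>H\<^esub> \<in> B" and a: "a \<ge> 1"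
  shows "pmf (conv_power (wreath K H) (switch_walk_switch K H \<eta> \<mu>) n) \<one>\<^bsub>wreath K H\<^esub> \<ge>
    exp (- (real n / real a + real (card B)) * return_cost K \<eta> a) * confined_prob H \<mu> B n \<one>\<^bsub>H\<^esub> \<one>\<^bsub>H\<^esub>"
proof -
  let ?W = "wreath K H" and ?q = "switch_walk_switch K H \<eta> \<mu>"
  let ?f = "\<one>\<^bsub>lamp_group K H\<^esub>"
  let ?E = "{\<xi>s. set (departures H \<one>\<^bsub>H\<^esub> \<xi>s) \<subseteq> B \<and> foldl (\<otimes>\<^bsub>H\<^esub>) \<one>\<^bsub>H\<^esub> \<xi>s = \<one>\<^bsub>H\<^esub>}"
  let ?\<delta> = "exp (- (real n / real a + real (card B)) * return_cost K \<eta> a)"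
  let ?P = "\<lambda>\<xi>s. pmf (map_pmf (\<lambda>g. (g, foldl (\<otimes>\<^bsub>H\<^esub>) \<one>\<^bsub>H\<^esub> \<xi>s)) (switches K \<eta> (switch_sites H \<one>\<^bsub>H\<^esub> \<xi>s) ?f)) (?f, \<one>\<^bsub>H\<^esub>)"
  have one: "\<one>\<^bsub>?W\<^esub> = (?f, \<one>\<^bsub>H\<^esub>)" by (simp add: wreath_def)
  have cp: "set_pmf (conv_power ?W ?q n) \<subseteq> carrier ?W"
    by (rule set_conv_power[OF W.is_group set_switch_walk_switch])
  have P: "?P \<xi>s \<ge> ?\<delta>" if \<xi>s: "\<xi>s \<in> ?E" "length \<xi>s = n" for \<xi>s
  proof -
    let ?m = "\<lambda>z. count_list (departures H \<one>\<^bsub>H\<^esub> \<xi>s) z"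
    have cnt: "count_list (switch_sites H \<one>\<^bsub>H\<^esub> \<xi>s) z = 2 * ?m z" for z
      using count_switch_sites[of H "\<one>\<^bsub>H\<^esub>" \<xi>s z] \<xi>s(1) by simp
    have "set (switch_sites H \<one>\<^bsub>H\<^esub> \<xi>s) \<subseteq> B"
      using set_switch_sites[of H "\<one>\<^bsub>H\<^esub>" \<xi>s] \<xi>s(1) B(3) by auto
    then have "pmf (switches K \<eta> (switch_sites H \<one>\<^bsub>H\<^esub> \<xi>s) ?f) ?f
        = (\<Prod>z\<in>B. pmf (conv_power K \<eta> (count_list (switch_sites H \<one>\<^bsub>H\<^esub> \<xi>s) z)) (inv\<^bsub>K\<^esub> (?f z) \<otimes>\<^bsub>K\<^esub> ?f z))"
      using B by (intro pmf_switches[OF K set_eta]) (auto simp: lamp_one)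
    also have "\<dots> = (\<Prod>z\<in>B. pmf (conv_power K \<eta> (2 * ?m z)) \<one>\<^bsub>K\<^esub>)"
      using B(2) by (intro prod.cong refl) (auto simp: cnt lamp_one)
    also have "\<dots> \<ge> exp (- (real (\<Sum>z\<in>B. ?m z) / real a + real (card B)) * return_cost K \<eta> a)"
      by (rule prod_return_prob_ge[OF K \<eta> \<eta>1 a B(1)])
    also have "(\<Sum>z\<in>B. ?m z) = n"
      using \<xi>s B(1) by (subst sum_count_set) auto
    finally show ?thesis
      using \<xi>s(1) pmf_map_inj'[of "\<lambda>g. (g, \<one>\<^bsub>H\<^esub>)" "switches K \<eta> (switch_sites H \<one>\<^bsub>H\<^esub> \<xi>s) ?f" ?f]
      by (simp add: inj_on_def)
  qed
  have "pmf (conv_power ?W ?q n) \<one>\<^bsub>?W\<^esub> = pmf (map_pmf (\<lambda>y. \<one>\<^bsub>?W\<^esub> \<otimes>\<^bsub>?W\<^esub> y) (conv_power ?W ?q n)) \<one>\<^bsub>?W\<^esub>"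
    by (subst pmf_map_mult_left[OF W.is_group cp]) auto
  also have "\<dots> = (\<integral>\<xi>s. ?P \<xi>s \<partial>measure_pmf (replicate_pmf n \<mu>))"
    using conv_power_switch_walk_switch[of ?f "\<one>\<^bsub>H\<^esub>" n] W.one_closed
    unfolding one by (simp add: pmf_bind)
  also have "\<dots> \<ge> (\<integral>\<xi>s. ?\<delta> * indicator ?E \<xi>s \<partial>measure_pmf (replicate_pmf n \<mu>))"
  proof (intro integral_mono_AE)
    show "AE \<xi>s in replicate_pmf n \<mu>. ?\<delta> * indicator ?E \<xi>s \<le> ?P \<xi>s"
      using P by (auto simp: AE_measure_pmf_iff set_replicate_pmf indicator_def)
  qed (auto intro!: measure_pmf.integrable_const_bound[where B=1] simp: pmf_le_1)
  finally show ?thesis by (simp add: confined_prob_def)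
qed

end

end

section \<open>Confinement in balls\<close>

lemma walk_at_closed:
  assumes "group G" "x \<in> carrier G" "set \<xi>s \<subseteq> carrier G"
  shows "walk_at G x \<xi>s k \<in> carrier G"
proof -
  interpret group G by fact
  have "foldl (\<otimes>\<^bsub>G\<^esub>) y ys \<in> carrier G" if "y \<in> carrier G" "set ys \<subseteq> carrier G" for y ys
    using that by (induction ys arbitrary: y) auto
  then show ?thesis
    using assms set_take_subset[of k \<xi>s] unfolding walk_at_def by blast
qed

lemma prob_sup_le_sum_confined_prob:
  assumes G: "group G" and \<mu>: "set_pmf \<mu> \<subseteq> carrier G" and x: "x \<in> carrier G"
    and fin: "finite {g \<in> carrier G. N g \<le> \<tau>}"
  shows "measure_pmf.prob (replicate_pmf n \<mu>)
      {\<xi>s. (SUP k\<in>{0..n}. N (walk_at G x \<xi>s k)) \<le> (R::real) \<and> N (walk_at G x \<xi>s n) \<le> \<tau>}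
    \<le> (\<Sum>y\<in>{g \<in> carrier G. N g \<le> \<tau>}. confined_prob G \<mu> {g \<in> carrier G. N g \<le> R} n x y)"
  unfolding sum_confined_prob[OF fin]
proof (rule measure_pmf.finite_measure_mono_AE)
  show "AE \<xi>s in replicate_pmf n \<mu>.
      \<xi>s \<in> {\<xi>s. (SUP k\<in>{0..n}. N (walk_at G x \<xi>s k)) \<le> R \<and> N (walk_at G x \<xi>s n) \<le> \<tau>} \<longrightarrow>
      \<xi>s \<in> {\<xi>s. set (departures G x \<xi>s) \<subseteq> {g \<in> carrier G. N g \<le> R} \<and>
        foldl (\<otimes>\<^bsub>G\<^esub>) x \<xi>s \<in> {g \<in> carrier G. N g \<le> \<tau>}}"
    unfolding AE_measure_pmf_iff
  proof (intro ballI impI)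
    fix \<xi>s assume "\<xi>s \<in> set_pmf (replicate_pmf n \<mu>)"
    then have \<xi>s: "length \<xi>s = n" "set \<xi>s \<subseteq> carrier G"
      using \<mu> by (auto simp: set_replicate_pmf in_lists_conv_set)
    assume "\<xi>s \<in> {\<xi>s. (SUP k\<in>{0..n}. N (walk_at G x \<xi>s k)) \<le> R \<and> N (walk_at G x \<xi>s n) \<le> \<tau>}"
    then have sup: "(SUP k\<in>{0..n}. N (walk_at G x \<xi>s k)) \<le> R" and last: "N (walk_at G x \<xi>s n) \<le> \<tau>"
      by auto
    have "N (walk_at G x \<xi>s k) \<le> R" if "k \<in> {0..n}" for k
      using cSUP_upper[OF that, of "\<lambda>k. N (walk_at G x \<xi>s k)"] sup by simp
    then have "set (departures G x \<xi>s) \<subseteq> {g \<in> carrier G. N g \<le> R}"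
      using departures_subset_walk_at[of G x \<xi>s] walk_at_closed[OF G x \<xi>s(2)] \<xi>s(1) by fastforce
    moreover have "foldl (\<otimes>\<^bsub>G\<^esub>) x \<xi>s \<in> {g \<in> carrier G. N g \<le> \<tau>}"
      using last walk_at_closed[OF G x \<xi>s(2), of n] \<xi>s(1) by (simp add: walk_at_def)
    ultimately show "\<xi>s \<in> {\<xi>s. set (departures G x \<xi>s) \<subseteq> {g \<in> carrier G. N g \<le> R} \<and>
        foldl (\<otimes>\<^bsub>G\<^esub>) x \<xi>s \<in> {g \<in> carrier G. N g \<le> \<tau>}}" by simp
  qed
qed simp

text \<open>
  This is the second condition of strong control at the radius \<open>\<tau> = \<gamma>\<^sub>1 r(n)\<close>, for which \<open>\<rho>(\<tau> / \<gamma>\<^sub>1) = n\<close>. Choosing the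
  radius from the time, and not conversely, avoids any inversion of \<open>r\<close>.
\<close>

lemma strongly_controlled_confinement:
  assumes G: "group G" and \<mu>: "set_pmf \<mu> \<subseteq> carrier G"
    and mono: "strict_mono_on {0<..} r" and ctrl: "strongly_controlled G \<mu> N r"
    and fin: "\<And>t. finite {g \<in> carrier G. N g \<le> t}"
  obtains \<epsilon> \<gamma>\<^sub>1 \<gamma>\<^sub>2 where "\<epsilon> > 0" "\<gamma>\<^sub>1 > 0" "\<gamma>\<^sub>2 \<ge> 1"
    "\<And>n x. n \<ge> 1 \<Longrightarrow> x \<in> carrier G \<Longrightarrow> N x \<le> \<gamma>\<^sub>1 * r (real n) \<Longrightarrow>
      \<epsilon> \<le> (\<Sum>y\<in>{g \<in> carrier G. N g \<le> \<gamma>\<^sub>1 * r (real n)}.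
             confined_prob G \<mu> {g \<in> carrier G. N g \<le> \<gamma>\<^sub>2 * (\<gamma>\<^sub>1 * r (real n))} n x y)"
proof -
  obtain \<epsilon> \<gamma>\<^sub>1 \<gamma>\<^sub>2 where pos: "\<epsilon> > 0" "\<gamma>\<^sub>1 > 0" "\<gamma>\<^sub>2 \<ge> 1"
    and *: "\<And>(n::nat) \<tau>. \<tau> / \<gamma>\<^sub>1 \<in> r ` {0<..} \<Longrightarrow> inv_into {0<..} r (\<tau> / \<gamma>\<^sub>1) / 2 \<le> real n \<Longrightarrow>
        real n \<le> inv_into {0<..} r (\<tau> / \<gamma>\<^sub>1) \<Longrightarrow>
        \<epsilon> \<le> (INF x\<in>{x \<in> carrier G. N x \<le> \<tau>}. measure_pmf.prob (replicate_pmf n \<mu>)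
             {\<xi>s. (SUP k\<in>{0..n}. N (walk_at G x \<xi>s k)) \<le> \<gamma>\<^sub>2 * \<tau> \<and> N (walk_at G x \<xi>s n) \<le> \<tau>})"
    using ctrl unfolding strongly_controlled_def Let_def by blast
  show thesis
  proof (rule that[OF pos])
    fix n :: nat and x assume n: "n \<ge> 1" and x: "x \<in> carrier G" "N x \<le> \<gamma>\<^sub>1 * r (real n)"
    let ?\<tau> = "\<gamma>\<^sub>1 * r (real n)"
    let ?p = "\<lambda>x. measure_pmf.prob (replicate_pmf n \<mu>)
             {\<xi>s. (SUP k\<in>{0..n}. N (walk_at G x \<xi>s k)) \<le> \<gamma>\<^sub>2 * ?\<tau> \<and> N (walk_at G x \<xi>s n) \<le> ?\<tau>}"
    have "inj_on r {0<..}" using mono by (rule strict_mono_on_imp_inj_on)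
    then have \<rho>: "inv_into {0<..} r (r (real n)) = real n" using n by simp
    have "\<epsilon> \<le> (INF x\<in>{x \<in> carrier G. N x \<le> ?\<tau>}. ?p x)"
      using n pos by (intro *) (auto simp: \<rho>)
    also have "\<dots> \<le> ?p x"
      using x by (intro cINF_lower bdd_belowI2[where m = 0]) auto
    also have "\<dots> \<le> (\<Sum>y\<in>{g \<in> carrier G. N g \<le> ?\<tau>}. confined_prob G \<mu> {g \<in> carrier G. N g \<le> \<gamma>\<^sub>2 * ?\<tau>} n x y)"
      by (rule prob_sup_le_sum_confined_prob[OF G \<mu> x(1) fin])
    finally show "\<epsilon> \<le> (\<Sum>y\<in>{g \<in> carrier G. N g \<le> ?\<tau>}. confined_prob G \<mu> {g \<in> carrier G. N g \<le> \<gamma>\<^sub>2 * ?\<tau>} n x y)" .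
  qed
qed

text \<open>
  A ball of radius at least \<open>1\<close> has positive cardinality by the lower volume bound, so it is finite. It contains at least
  one element, which is incompatible with a bound by a negative power of the radius.
\<close>

lemma volume_growth:
  assumes G: "group G" and norm: "group_norm G N"
    and vol: "comparable_on {1..} (ball_volume G N) (\<lambda>t. t powr D)"
  shows "finite {g \<in> carrier G. N g \<le> t}" and "D \<ge> 0"
proof -
  interpret group G by fact
  obtain c C where c: "0 < c" "c \<le> C"
    and V: "\<And>t. t \<ge> 1 \<Longrightarrow> c * t powr D \<le> ball_volume G N t \<and> ball_volume G N t \<le> C * t powr D"
    using vol unfolding comparable_on_def by auto
  have pos: "card {g \<in> carrier G. N g \<le> t} > 0" if "t \<ge> 1" for t
  proof -
    have "0 < c * t powr D" using c that by simp
    also have "\<dots> \<le> ball_volume G N t" using V that by blast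
    finally show ?thesis by (simp add: ball_volume_def)
  qed
  show "finite {g \<in> carrier G. N g \<le> t}"
    by (rule finite_subset[OF _ card_ge_0_finite[OF pos[of "max 1 t"]]]) auto
  show "D \<ge> 0"
  proof (rule ccontr)
    assume "\<not> D \<ge> 0"
    then have "((\<lambda>t::real. C * t powr D) \<longlongrightarrow> C * 0) at_top"
      by (intro tendsto_intros tendsto_neg_powr filterlim_ident) auto
    then have "\<forall>\<^sub>F t::real in at_top. C * t powr D < 1" by (rule order_tendstoD) simp
    then have "\<forall>\<^sub>F t::real in at_top. C * t powr D < 1 \<and> t \<ge> 1"
      using eventually_ge_at_top by (rule eventually_conj)
    then obtain t :: real where t: "C * t powr D < 1" "t \<ge> 1"
      unfolding eventually_at_top_linorder by blast
    have "1 \<le> ball_volume G N t" using pos[OF t(2)] by (simp add: ball_volume_def)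
    then show False using V[OF t(2)] t(1) by linarith
  qed
qed

section \<open>Functions comparable under power substitutions\<close>

text \<open>
  Divide the increment \<open>c\<close> into at most \<open>\<bar>c\<bar> / \<delta> + 1\<close> equal parts of size at most \<open>\<delta>\<close>.
\<close>

lemma iterated_increment_bounded:
  fixes g :: "real \<Rightarrow> real"
  assumes "\<delta> > 0" and M: "\<And>c v. \<bar>c\<bar> \<le> \<delta> \<Longrightarrow> \<bar>g (v + c) - g v\<bar> \<le> M"
  shows "\<bar>g (v + c) - g v\<bar> \<le> (\<bar>c\<bar> / \<delta> + 1) * M"
proof -
  define k where "k = nat \<lceil>\<bar>c\<bar> / \<delta>\<rceil>"
  define d where "d = (if k = 0 then 0 else c / real k)"
  have "0 \<le> \<bar>c\<bar> / \<delta>" using \<open>\<delta> > 0\<close> by simp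
  then have k_ge: "\<bar>c\<bar> / \<delta> \<le> real k" and k_le: "real k \<le> \<bar>c\<bar> / \<delta> + 1"
    unfolding k_def by linarith+
  have kd: "real k * d = c"
    using k_ge \<open>\<delta> > 0\<close> by (auto simp: d_def field_simps)
  have "\<bar>d\<bar> \<le> \<delta>"
    using k_ge \<open>\<delta> > 0\<close> by (auto simp: d_def field_simps abs_if)
  then have d: "\<bar>g (w + d) - g w\<bar> \<le> M" for w using M by blast
  have "\<bar>g (v + real j * d) - g v\<bar> \<le> real j * M" for j
  proof (induction j)
    case (Suc j)
    have "g (v + real (Suc j) * d) = g ((v + real j * d) + d)" by (simp add: algebra_simps)
    then show ?case using Suc d[of "v + real j * d"] by (simp add: algebra_simps)
  qed simp
  from this[of k] have "\<bar>g (v + c) - g v\<bar> \<le> real k * M" by (simp add: kd)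
  also have "\<dots> \<le> (\<bar>c\<bar> / \<delta> + 1) * M"
    using k_le d[of 0] by (intro mult_right_mono) auto
  finally show ?thesis .
qed

text \<open>
  The sets of those \<open>c\<close> for which the increments are bounded by a given natural number are closed and cover the
  line, so by Baire's theorem one of them contains an interval around some \<open>c\<^sub>0\<close>. Writing \<open>c\<close> as \<open>(c\<^sub>0 + c) - c\<^sub>0\<close>
  moves this interval to the origin; larger increments are then iterated small ones.
\<close>

lemma increment_bounded_uniformly:
  fixes g :: "real \<Rightarrow> real"
  assumes cont: "continuous_on UNIV g"
    and bdd: "\<And>c. \<exists>M. \<forall>v. \<bar>g (v + c) - g v\<bar> \<le> M"
  shows "\<exists>B>0. \<forall>v c. \<bar>g (v + c) - g v\<bar> \<le> B * (\<bar>c\<bar> + 1)"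
proof -
  define A where "A M = {c. \<forall>v. \<bar>g (v + c) - g v\<bar> \<le> real M}" for M :: nat
  have cl: "closed (A M)" for M
  proof -
    have "A M = (\<Inter>v. {c. \<bar>g (v + c) - g v\<bar> \<le> real M})" by (auto simp: A_def)
    moreover have "closed {c. \<bar>g (v + c) - g v\<bar> \<le> real M}" for v
      by (intro closed_Collect_le continuous_intros continuous_on_compose2[OF cont]) auto
    ultimately show ?thesis by auto
  qed
  \<comment> \<open>Otherwise the complements are dense open sets with empty intersection.\<close>
  have "\<exists>M. interior (A M) \<noteq> {}"
  proof (rule ccontr)
    assume "\<nexists>M. interior (A M) \<noteq> {}"
    then have "UNIV \<subseteq> closure (\<Inter>M. - A M)"
      by (intro Baire) (use cl in \<open>auto simp: closure_complement\<close>)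
    moreover have "(\<Inter>M. - A M) = {}"
    proof -
      have "\<exists>M. c \<in> A M" for c
      proof -
        obtain M where M: "\<And>v. \<bar>g (v + c) - g v\<bar> \<le> M" using bdd by blast
        obtain k :: nat where "M \<le> real k" using real_arch_simple by blast
        then have "c \<in> A k" using M by (auto simp: A_def intro: order_trans)
        then show ?thesis ..
      qed
      then show ?thesis by blast
    qed
    ultimately show False by simp
  qed
  then obtain M c0 where "c0 \<in> interior (A M)" by blast
  then obtain \<delta> where \<delta>: "\<delta> > 0" "cball c0 \<delta> \<subseteq> A M"
    by (meson interior_subset mem_interior_cball)
  have "\<bar>g (v + c) - g v\<bar> \<le> 2 * real M" if "\<bar>c\<bar> \<le> \<delta>" for v c
  proof -
    have "c0 \<in> A M" "c0 + c \<in> A M" using \<delta> that by (auto simp: subset_iff dist_real_def)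
    then have "\<bar>g ((v - c0) + c0) - g (v - c0)\<bar> \<le> real M"
      "\<bar>g ((v - c0) + (c0 + c)) - g (v - c0)\<bar> \<le> real M"
      unfolding A_def by blast+
    then show ?thesis by (simp add: algebra_simps)
  qed
  note * = iterated_increment_bounded[OF \<delta>(1), of g "2 * real M", OF this]
  define B where "B = (1 / \<delta> + 1) * (2 * real M) + 1"
  have "B > 0" using \<delta>(1) by (auto simp: B_def intro!: add_nonneg_pos)
  moreover have "\<bar>g (v + c) - g v\<bar> \<le> B * (\<bar>c\<bar> + 1)" for v c
  proof -
    have "(\<bar>c\<bar> / \<delta> + 1) \<le> (1 / \<delta> + 1) * (\<bar>c\<bar> + 1)"
      using \<delta>(1) by (auto simp: field_simps)
    then have "(\<bar>c\<bar> / \<delta> + 1) * (2 * real M) \<le> (1 / \<delta> + 1) * (\<bar>c\<bar> + 1) * (2 * real M)"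
      by (rule mult_right_mono) auto
    also have "\<dots> = (1 / \<delta> + 1) * (2 * real M) * (\<bar>c\<bar> + 1)" by (simp only: mult_ac)
    also have "\<dots> \<le> B * (\<bar>c\<bar> + 1)" by (intro mult_right_mono) (auto simp: B_def)
    finally show ?thesis using *[of v c] by linarith
  qed
  ultimately show ?thesis by blast
qed

text \<open>
  In the variable \<open>v = ln (ln t)\<close> the substitution of \<open>t powr exp c\<close> for \<open>t\<close> is the translation by \<open>c\<close>. The hypothesis
  says that \<open>v \<mapsto> ln (l (exp (exp v)))\<close> has bounded increments for each \<open>c\<close>, to which
  \<open>increment_bounded_uniformly\<close> applies.
\<close>

lemma log_increment_bound:
  fixes l :: "real \<Rightarrow> real"
  assumes pos: "\<forall>t>0. l t > 0" and cont: "continuous_on {0<..} l"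
    and powr: "\<forall>a>0. comparable_on {1..} (\<lambda>t. l (t powr a)) l"
  shows "\<exists>B>0. \<forall>s>1. \<forall>t>1. \<bar>ln (l s) - ln (l t)\<bar> \<le> B * (\<bar>ln (ln s) - ln (ln t)\<bar> + 1)"
proof -
  define g where "g v = ln (l (exp (exp v)))" for v :: real
  have "l (exp (exp v)) \<noteq> 0" for v :: real
    using pos exp_gt_zero less_irrefl by metis
  then have "continuous_on UNIV g"
    unfolding g_def
    by (intro continuous_on_ln continuous_on_compose2[OF cont] continuous_intros) auto
  moreover have "\<exists>M. \<forall>v. \<bar>g (v + c) - g v\<bar> \<le> M" for c
  proof -
    obtain c1 c2 where c: "0 < c1" "c1 \<le> c2"
      and *: "\<And>t. t \<ge> 1 \<Longrightarrow> c1 * l t \<le> l (t powr exp c) \<and> l (t powr exp c) \<le> c2 * l t"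
      using powr unfolding comparable_on_def by (meson atLeast_iff exp_gt_zero)
    have "\<bar>g (v + c) - g v\<bar> \<le> \<bar>ln c1\<bar> + \<bar>ln c2\<bar>" for v
    proof -
      define t where "t = exp (exp v)"
      have t: "t \<ge> 1" "t > 0" by (auto simp: t_def)
      have e: "t powr exp c = exp (exp (v + c))" by (simp add: t_def powr_def exp_add)
      have lt: "l t > 0" using pos t by auto
      have "ln (c1 * l t) \<le> ln (l (t powr exp c))" "ln (l (t powr exp c)) \<le> ln (c2 * l t)"
        using *[OF t(1)] c lt pos t by (auto intro!: ln_mono)
      then have "ln c1 + ln (l t) \<le> g (v + c)" "g (v + c) \<le> ln c2 + ln (l t)"
        using c lt by (auto simp: ln_mult e g_def)
      then show ?thesis by (auto simp: g_def t_def)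
    qed
    then show ?thesis by blast
  qed
  ultimately obtain B where B: "B > 0" "\<And>v c. \<bar>g (v + c) - g v\<bar> \<le> B * (\<bar>c\<bar> + 1)"
    using increment_bounded_uniformly by metis
  have "\<bar>ln (l s) - ln (l t)\<bar> \<le> B * (\<bar>ln (ln s) - ln (ln t)\<bar> + 1)" if "s > 1" "t > 1" for s t
    using B(2)[of "ln (ln t)" "ln (ln s) - ln (ln t)"] that by (simp add: g_def)
  with B(1) show ?thesis by blast
qed

lemma comparable_between_powers:
  fixes l :: "real \<Rightarrow> real"
  assumes pos: "\<forall>t>0. l t > 0" and cont: "continuous_on {0<..} l"
    and powr: "\<forall>a>0. comparable_on {1..} (\<lambda>t. l (t powr a)) l"
    and A: "A \<ge> 1"
  shows "\<exists>C>0. \<forall>s>1. \<forall>t>1. ln t \<le> A * ln s \<longrightarrow> ln s \<le> A * ln t \<longrightarrow> l s \<le> C * l t"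
proof -
  obtain B where B: "B > 0"
    "\<And>s t. s > 1 \<Longrightarrow> t > 1 \<Longrightarrow> \<bar>ln (l s) - ln (l t)\<bar> \<le> B * (\<bar>ln (ln s) - ln (ln t)\<bar> + 1)"
    using log_increment_bound[OF pos cont powr] by blast
  have "l s \<le> exp (B * (ln A + 1)) * l t"
    if "s > 1" "t > 1" "ln t \<le> A * ln s" "ln s \<le> A * ln t" for s t
  proof -
    have "ln (ln t) \<le> ln (A * ln s)" "ln (ln s) \<le> ln (A * ln t)"
      using that A by (auto intro!: ln_mono)
    then have "\<bar>ln (ln s) - ln (ln t)\<bar> \<le> ln A"
      using that A by (auto simp: ln_mult)
    then have "B * (\<bar>ln (ln s) - ln (ln t)\<bar> + 1) \<le> B * (ln A + 1)"
      using B(1) by auto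
    then have "ln (l s) \<le> B * (ln A + 1) + ln (l t)"
      using B(2)[OF that(1,2)] by linarith
    then have "exp (ln (l s)) \<le> exp (B * (ln A + 1) + ln (l t))" by simp
    then show ?thesis using pos that by (simp add: exp_add)
  qed
  then show ?thesis by (intro exI[of _ "exp (B * (ln A + 1))"]) auto
qed

text \<open>
  Comparing with the fixed point \<open>exp 1\<close>, where \<open>ln (ln t) = 0\<close>, shows that \<open>ln (l t)\<close> is of order at most
  \<open>ln (ln t)\<close>: the function \<open>l\<close> is bounded above and below by powers of the logarithm.
\<close>

lemma ln_negligible:
  fixes l :: "real \<Rightarrow> real"
  assumes pos: "\<forall>t>0. l t > 0" and cont: "continuous_on {0<..} l"
    and powr: "\<forall>a>0. comparable_on {1..} (\<lambda>t. l (t powr a)) l"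
    and d: "\<delta> > 0"
  shows "\<forall>\<^sub>F t in at_top. \<bar>ln (l t)\<bar> \<le> \<delta> * ln t"
proof -
  obtain B where B: "B > 0"
    "\<And>s t. s > 1 \<Longrightarrow> t > 1 \<Longrightarrow> \<bar>ln (l s) - ln (l t)\<bar> \<le> B * (\<bar>ln (ln s) - ln (ln t)\<bar> + 1)"
    using log_increment_bound[OF pos cont powr] by blast
  define A where "A = \<bar>ln (l (exp 1))\<bar> + B"
  have 0: "((\<lambda>u. (A + B * ln u) / u) \<longlongrightarrow> 0) at_top"
    using tendsto_add[OF tendsto_mult[OF tendsto_const[of A] tendsto_inverse_0_at_top[OF filterlim_ident]]
       tendsto_mult[OF tendsto_const[of B] ln_x_over_x_tendsto_0]]
    by (simp add: field_simps add_divide_distrib)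
  have "\<forall>\<^sub>F u in at_top. (A + B * ln u) / u < \<delta>"
    using order_tendstoD(2)[OF 0 d] .
  then have "\<forall>\<^sub>F u in at_top. A + B * ln u \<le> \<delta> * u"
    using eventually_gt_at_top[of 0] by eventually_elim (simp add: field_simps)
  then have "\<forall>\<^sub>F t in at_top. A + B * ln (ln t) \<le> \<delta> * ln t"
    using ln_at_top by (auto simp: filterlim_iff)
  then show ?thesis
    using eventually_gt_at_top[of "exp 1"]
  proof eventually_elim
    case (elim t)
    then have t: "t > 1" by (smt (verit) one_less_exp_iff)
    have "1 \<le> ln t" using elim t by (simp add: ln_ge_iff)
    then have "\<bar>ln (ln t)\<bar> = ln (ln t)" by simp
    then show ?case using elim B(2)[OF t, of "exp 1"] by (simp add: A_def algebra_simps)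
  qed
qed

section \<open>Choice of scales\<close>

text \<open>
  The scales are given by their logarithms \<open>u\<close>. Bounds of \<open>u\<close> by multiples of \<open>ln t\<close> say that \<open>exp u\<close> lies between two
  fixed powers of \<open>t\<close>, and rounding up to an integer stays in such a range.
\<close>

lemma comparable_at_ceiling:
  fixes l :: "real \<Rightarrow> real"
  assumes l: "\<forall>t>0. l t > 0" "continuous_on {0<..} l"
      "\<forall>a>0. comparable_on {1..} (\<lambda>t. l (t powr a)) l"
    and c: "c1 > 0" "c2 > 0"
  shows "\<exists>C>0. \<forall>t\<ge>exp 1. \<forall>u. c1 * ln t \<le> u \<longrightarrow> u \<le> c2 * ln t \<longrightarrow>
    exp u \<le> real (nat \<lceil>exp u\<rceil>) \<and> real (nat \<lceil>exp u\<rceil>) \<le> 2 * exp u \<and> l (real (nat \<lceil>exp u\<rceil>)) \<le> C * l t"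
proof -
  define A where "A = 1 + 1 / c1 + c2"
  have A: "A \<ge> 1" using c by (simp add: A_def)
  obtain C where C: "C > 0" "\<And>s t. s > 1 \<Longrightarrow> t > 1 \<Longrightarrow> ln t \<le> A * ln s \<Longrightarrow> ln s \<le> A * ln t \<Longrightarrow> l s \<le> C * l t"
    using comparable_between_powers[OF l A] by blast
  show ?thesis
  proof (intro exI[of _ C] conjI allI impI C(1))
    fix t u :: real assume t: "t \<ge> exp 1" and u: "c1 * ln t \<le> u" "u \<le> c2 * ln t"
    define b where "b = real (nat \<lceil>exp u\<rceil>)"
    have t1: "t > 1" using t by (meson less_le_trans one_less_exp_iff zero_less_one)
    have ln_t: "ln t \<ge> 1" using t t1 by (simp add: ln_ge_iff)
    have u0: "u > 0" using u(1) ln_t c(1) by (smt (verit) mult_pos_pos)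
    have e: "exp u > 1" using u0 by simp
    have lo: "exp u \<le> b" and hi: "b \<le> 2 * exp u" using e unfolding b_def by linarith+
    then show "exp u \<le> b" "b \<le> 2 * exp u" by auto
    have b1: "b > 1" using lo e by linarith
    have "ln b \<ge> u" using lo b1 by (simp add: ln_ge_iff)
    have "ln b \<le> ln (2 * exp u)" using hi b1 by simp
    also have "\<dots> = ln 2 + u" by (simp add: ln_mult)
    also have "\<dots> \<le> 1 + u" using ln_le_minus_one[of "2::real"] by simp
    finally have "ln b \<le> 1 + u" .
    have "ln t \<le> (1 / c1) * ln b" using u(1) \<open>ln b \<ge> u\<close> c(1) by (simp add: field_simps)
    also have "\<dots> \<le> A * ln b" using b1 c by (intro mult_right_mono) (auto simp: A_def)
    finally have 1: "ln t \<le> A * ln b" .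
    have "ln b \<le> (1 + c2) * ln t" using \<open>ln b \<le> 1 + u\<close> u(2) ln_t by (simp add: distrib_right)
    also have "\<dots> \<le> A * ln t" using ln_t c by (intro mult_right_mono) (auto simp: A_def)
    finally have 2: "ln b \<le> A * ln t" .
    show "l b \<le> C * l t" using C(2)[OF b1 t1 1 2] .
  qed
qed

text \<open>
  Here \<open>W\<close> is the order of the volume \<open>r(b)\<^sup>D\<close>, the scale \<open>b\<close> is \<open>t / \<Theta>(t)\<close> and \<open>a\<close> is \<open>t / W\<close>, both rounded up. In terms of logarithms all
  these quantities are linear in \<open>ln t\<close>, \<open>ln (l1 t)\<close> and \<open>ln (l2 t)\<close>, the last two being negligible, and the
  definition of \<open>\<Theta>\<close> is the solution of the linear equation \<open>ln W + \<gamma> (ln t - ln W) + ln (l2 t) = ln (\<Theta> t)\<close> that expresses the balance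
  \<open>t / b = W (t / W) powr \<gamma> l2(t)\<close>.
\<close>

lemma optimal_scales:
  fixes l1 l2 :: "real \<Rightarrow> real" and D \<beta> \<gamma> :: real
  assumes l1: "\<forall>t>0. l1 t > 0" "continuous_on {0<..} l1" "\<forall>a>0. comparable_on {1..} (\<lambda>t. l1 (t powr a)) l1"
    and l2: "\<forall>t>0. l2 t > 0" "continuous_on {0<..} l2" "\<forall>a>0. comparable_on {1..} (\<lambda>t. l2 (t powr a)) l2"
    and D: "D \<ge> 0" and \<beta>: "\<beta> > 0" and \<gamma>: "0 \<le> \<gamma>" "\<gamma> < 1"
  defines "\<Theta> \<equiv> \<lambda>t. t powr ((D * (1 - \<gamma>) + \<gamma> * \<beta>) / (D * (1 - \<gamma>) + \<beta>))
             * l1 t powr (\<beta> * D * (1 - \<gamma>) / (D * (1 - \<gamma>) + \<beta>)) * l2 t powr (\<beta> / (D * (1 - \<gamma>) + \<beta>))"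
  shows "\<exists>C>0. \<forall>\<^sub>F t in at_top. \<exists>a b :: nat. \<exists>W>0. a \<ge> 1 \<and> b \<ge> 1 \<and>
    t / \<Theta> t \<le> real b \<and> t / W \<le> real a \<and>
    (real b powr (1 / \<beta>) * l1 (real b)) powr D \<le> C * W \<and>
    W * (real a powr \<gamma> * l2 (real a)) \<le> C * \<Theta> t"
proof -
  define d where "d = D * (1 - \<gamma>)"
  define s where "s = d + \<beta>"
  have d: "d \<ge> 0" and s: "s > 0" using D \<beta> \<gamma> by (auto simp: d_def s_def add_nonneg_pos)
  \<comment> \<open>Small enough for the contributions of \<open>l1\<close> and \<open>l2\<close> to change the leading terms of \<open>u\<close> and \<open>v\<close>
    only by a factor between \<open>1/2\<close> and \<open>3/2\<close>.\<close>
  define \<delta> where "\<delta> = min ((1 - \<gamma>) / (2 * (d + 1))) (1 / (2 * (D + D / \<beta> + 1)))"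
  have \<delta>: "\<delta> > 0" using d \<gamma> D \<beta> by (auto simp: \<delta>_def intro!: divide_pos_pos add_nonneg_pos)
  have \<delta>1: "(d + 1) * \<delta> \<le> (1 - \<gamma>) / 2"
  proof -
    have "(d + 1) * \<delta> \<le> (d + 1) * ((1 - \<gamma>) / (2 * (d + 1)))"
      using d by (intro mult_left_mono) (auto simp: \<delta>_def)
    also have "\<dots> = (1 - \<gamma>) / 2" using d by (simp add: field_simps)
    finally show ?thesis .
  qed
  have \<delta>2: "(D + D / \<beta>) * \<delta> \<le> 1 / 2"
  proof -
    have p: "D + D / \<beta> \<ge> 0" using D \<beta> by simp
    have "(D + D / \<beta>) * \<delta> \<le> (D + D / \<beta> + 1) * (1 / (2 * (D + D / \<beta> + 1)))"
      using p \<delta> by (intro mult_mono) (auto simp: \<delta>_def)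
    also have "\<dots> = 1 / 2" using p by simp
    finally show ?thesis .
  qed
  define c where "c = \<beta> * (1 - \<gamma>) / (2 * s)"
  define c' where "c' = \<beta> / (2 * s)"
  have c: "c > 0" "c' > 0" using \<beta> \<gamma> s by (auto simp: c_def c'_def)
  obtain C1 where C1: "C1 > 0" "\<And>t u. t \<ge> exp 1 \<Longrightarrow> c * ln t \<le> u \<Longrightarrow> u \<le> 3 * c * ln t \<Longrightarrow>
      exp u \<le> real (nat \<lceil>exp u\<rceil>) \<and> real (nat \<lceil>exp u\<rceil>) \<le> 2 * exp u \<and> l1 (real (nat \<lceil>exp u\<rceil>)) \<le> C1 * l1 t"
    using comparable_at_ceiling[OF l1 c(1), of "3 * c"] c by auto
  obtain C2 where C2: "C2 > 0" "\<And>t u. t \<ge> exp 1 \<Longrightarrow> c' * ln t \<le> u \<Longrightarrow> u \<le> 3 * c' * ln t \<Longrightarrow>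
      exp u \<le> real (nat \<lceil>exp u\<rceil>) \<and> real (nat \<lceil>exp u\<rceil>) \<le> 2 * exp u \<and> l2 (real (nat \<lceil>exp u\<rceil>)) \<le> C2 * l2 t"
    using comparable_at_ceiling[OF l2 c(2), of "3 * c'"] c by auto
  define C where "C = (2 powr (1 / \<beta>) * C1) powr D + 2 powr \<gamma> * C2"
  have Cpos: "C > 0" using C2(1) by (auto simp: C_def intro!: add_nonneg_pos)
  have "\<forall>\<^sub>F t in at_top. \<exists>a b :: nat. \<exists>W>0. a \<ge> 1 \<and> b \<ge> 1 \<and>
    t / \<Theta> t \<le> real b \<and> t / W \<le> real a \<and>
    (real b powr (1 / \<beta>) * l1 (real b)) powr D \<le> C * W \<and>
    W * (real a powr \<gamma> * l2 (real a)) \<le> C * \<Theta> t"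
    using ln_negligible[OF l1 \<delta>] ln_negligible[OF l2 \<delta>] eventually_ge_at_top[of "exp 1"]
  proof eventually_elim
    case (elim t)
    define L \<nu>1 \<nu>2 where "L = ln t" and "\<nu>1 = ln (l1 t)" and "\<nu>2 = ln (l2 t)"
    have t0: "t > 0" using elim(3) by (meson exp_gt_zero less_le_trans)
    have L: "L \<ge> 1" using elim(3) t0 by (simp add: L_def ln_ge_iff)
    have l1t: "l1 t = exp \<nu>1" "l1 t > 0" and l2t: "l2 t = exp \<nu>2" "l2 t > 0" and tL: "t = exp L"
      using l1(1) l2(1) t0 by (auto simp: \<nu>1_def \<nu>2_def L_def)
    have \<nu>: "\<bar>\<nu>1\<bar> \<le> \<delta> * L" "\<bar>\<nu>2\<bar> \<le> \<delta> * L" using elim by (auto simp: \<nu>1_def \<nu>2_def L_def)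
    \<comment> \<open>The logarithms of \<open>b\<close>, \<open>W\<close> and \<open>a\<close>, up to rounding.\<close>
    define u where "u = (\<beta> / s) * ((1 - \<gamma>) * L - d * \<nu>1 - \<nu>2)"
    define w where "w = (D / \<beta>) * u + D * \<nu>1"
    define v where "v = (\<beta> / s) * (L - D * \<nu>1 + (D / \<beta>) * \<nu>2)"
    have v: "v = L - w"
    proof -
      have "s * v = \<beta> * L - \<beta> * D * \<nu>1 + D * \<nu>2"
        using s \<beta> by (simp add: v_def algebra_simps)
      moreover have "s * w = D * ((1 - \<gamma>) * L - d * \<nu>1 - \<nu>2) + s * (D * \<nu>1)"
        using s \<beta> by (simp add: w_def u_def distrib_left)
      ultimately have "s * v = s * (L - w)"
        by (simp add: s_def d_def algebra_simps)
      then show ?thesis using s by simp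
    qed
    have \<Theta>: "\<Theta> t = exp (L - u)"
    proof -
      have "\<Theta> t = exp (L * ((d + \<gamma> * \<beta>) / s) + \<nu>1 * (\<beta> * d / s) + \<nu>2 * (\<beta> / s))"
        using t0 l1t(2) l2t(2)
        by (simp add: \<Theta>_def powr_def exp_add L_def \<nu>1_def \<nu>2_def s_def d_def mult_ac)
      also have "L * ((d + \<gamma> * \<beta>) / s) + \<nu>1 * (\<beta> * d / s) + \<nu>2 * (\<beta> / s) = L - u"
      proof -
        have "L * (d + \<gamma> * \<beta>) + \<nu>1 * (\<beta> * d) + \<nu>2 * \<beta> = s * L - \<beta> * ((1 - \<gamma>) * L - d * \<nu>1 - \<nu>2)"
          by (simp add: s_def algebra_simps)
        also have "\<dots> = s * (L - u)" using s by (simp add: u_def right_diff_distrib)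
        finally have "(L * (d + \<gamma> * \<beta>) + \<nu>1 * (\<beta> * d) + \<nu>2 * \<beta>) / s = L - u" using s by simp
        then show ?thesis by (simp only: times_divide_eq_right add_divide_distrib[symmetric])
      qed
      finally show ?thesis .
    qed
    have w_u: "w + \<gamma> * v + \<nu>2 = L - u"
    proof -
      have sv: "s * v = \<beta> * L - \<beta> * D * \<nu>1 + D * \<nu>2"
        using s \<beta> by (simp add: v_def algebra_simps)
      have su: "s * u = \<beta> * ((1 - \<gamma>) * L - d * \<nu>1 - \<nu>2)"
        using s by (simp add: u_def)
      have "s * (u - (1 - \<gamma>) * v + \<nu>2) = s * u - (1 - \<gamma>) * (s * v) + s * \<nu>2"
        by (simp add: algebra_simps)
      also have "\<dots> = 0"
        unfolding sv su by (simp add: s_def d_def algebra_simps)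
      finally have "u - (1 - \<gamma>) * v + \<nu>2 = 0" using s by simp
      then show ?thesis unfolding v by (simp add: algebra_simps)
    qed
    have u_bds: "c * L \<le> u" "u \<le> 3 * c * L"
    proof -
      have "\<bar>d * \<nu>1 + \<nu>2\<bar> \<le> d * \<bar>\<nu>1\<bar> + \<bar>\<nu>2\<bar>" using d by (simp add: abs_mult order_trans[OF abs_triangle_ineq])
      also have "\<dots> \<le> d * (\<delta> * L) + \<delta> * L" using \<nu> d by (intro add_mono mult_left_mono)
      also have "\<dots> = ((d + 1) * \<delta>) * L" by (simp add: algebra_simps)
      also have "\<dots> \<le> (1 - \<gamma>) / 2 * L" using \<delta>1 L by (intro mult_right_mono) auto
      finally have "(1 - \<gamma>) * L / 2 \<le> (1 - \<gamma>) * L - d * \<nu>1 - \<nu>2" "(1 - \<gamma>) * L - d * \<nu>1 - \<nu>2 \<le> 3 * ((1 - \<gamma>) * L / 2)"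
        by linarith+
      then have "(\<beta> / s) * ((1 - \<gamma>) * L / 2) \<le> u" "u \<le> (\<beta> / s) * (3 * ((1 - \<gamma>) * L / 2))"
        unfolding u_def using \<beta> s by (intro mult_left_mono; simp)+
      then show "c * L \<le> u" "u \<le> 3 * c * L" by (simp_all add: c_def)
    qed
    have v_bds: "c' * L \<le> v" "v \<le> 3 * c' * L"
    proof -
      have "\<bar>- D * \<nu>1 + (D / \<beta>) * \<nu>2\<bar> \<le> D * \<bar>\<nu>1\<bar> + (D / \<beta>) * \<bar>\<nu>2\<bar>"
        using abs_triangle_ineq[of "- D * \<nu>1" "(D / \<beta>) * \<nu>2"] D \<beta> by (simp add: abs_mult)
      also have "\<dots> \<le> D * (\<delta> * L) + (D / \<beta>) * (\<delta> * L)" using \<nu> D \<beta> by (intro add_mono mult_left_mono) auto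
      also have "\<dots> = ((D + D / \<beta>) * \<delta>) * L" by (simp add: algebra_simps)
      also have "\<dots> \<le> 1 / 2 * L" using \<delta>2 L by (intro mult_right_mono) auto
      finally have "L / 2 \<le> L - D * \<nu>1 + (D / \<beta>) * \<nu>2" "L - D * \<nu>1 + (D / \<beta>) * \<nu>2 \<le> 3 * (L / 2)"
        by linarith+
      then have "(\<beta> / s) * (L / 2) \<le> v" "v \<le> (\<beta> / s) * (3 * (L / 2))"
        unfolding v_def using \<beta> s by (intro mult_left_mono; simp)+
      then show "c' * L \<le> v" "v \<le> 3 * c' * L" by (simp_all add: c'_def)
    qed
    define b where "b = nat \<lceil>exp u\<rceil>"
    define a where "a = nat \<lceil>exp v\<rceil>"
    define W where "W = exp w"
    have b: "exp u \<le> real b" "real b \<le> 2 * exp u" "l1 (real b) \<le> C1 * l1 t"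
      using C1(2)[OF elim(3), of u] u_bds unfolding b_def L_def by auto
    have a: "exp v \<le> real a" "real a \<le> 2 * exp v" "l2 (real a) \<le> C2 * l2 t"
      using C2(2)[OF elim(3), of v] v_bds unfolding a_def L_def by auto
    have ab: "real a > 0" "real b > 0" using a(1) b(1) by (meson exp_gt_zero less_le_trans)+
    have "(real b powr (1 / \<beta>) * l1 (real b)) powr D \<le> ((2 * exp u) powr (1 / \<beta>) * (C1 * l1 t)) powr D"
      using b ab l1(1) \<beta> D by (intro powr_mono2 mult_mono) (auto simp: less_imp_le)
    also have "\<dots> = (2 powr (1 / \<beta>) * C1) powr D * W"
    proof -
      have e1: "(2 * exp u) powr (1 / \<beta>) * (C1 * l1 t) = (2 powr (1 / \<beta>) * C1) * exp (u / \<beta> + \<nu>1)"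
        by (simp add: powr_mult l1t exp_add exp_powr_real mult_ac)
      have e2: "exp (u / \<beta> + \<nu>1) powr D = W"
        by (simp add: exp_powr_real W_def w_def algebra_simps)
      show ?thesis unfolding e1 using C1(1) by (subst powr_mult) (auto simp: e2)
    qed
    also have "\<dots> \<le> C * W" using C2(1) by (intro mult_right_mono) (auto simp: C_def W_def)
    finally have 1: "(real b powr (1 / \<beta>) * l1 (real b)) powr D \<le> C * W" .
    have "W * (real a powr \<gamma> * l2 (real a)) \<le> W * ((2 * exp v) powr \<gamma> * (C2 * l2 t))"
      using a ab l2(1) \<gamma> by (intro mult_left_mono mult_mono powr_mono2) (auto simp: less_imp_le W_def)
    also have "\<dots> = 2 powr \<gamma> * C2 * exp (w + \<gamma> * v + \<nu>2)"
      by (simp add: powr_mult l2t exp_add exp_powr_real W_def mult_ac)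
    also have "\<dots> = 2 powr \<gamma> * C2 * \<Theta> t" by (simp only: w_u \<Theta>)
    also have "\<dots> \<le> C * \<Theta> t" by (intro mult_right_mono) (auto simp: C_def \<Theta>)
    finally have 2: "W * (real a powr \<gamma> * l2 (real a)) \<le> C * \<Theta> t" .
    have "t / \<Theta> t = exp u" unfolding \<Theta> by (subst tL) (simp flip: exp_diff)
    moreover have "t / W = exp v" unfolding W_def v by (subst tL) (simp flip: exp_diff)
    ultimately show ?case
      using 1 2 a(1) b(1) ab by (intro exI[of _ a] exI[of _ b] exI[of _ W]) (auto simp: W_def)
  qed
  with Cpos show ?thesis by blast
qed
section \<open>Return probabilities of the switch-walk-switch walk\<close>

lemma pmf_switch_walk_switch_one_pos:
  assumes H: "group H" and K: "group K" and \<mu>: "pmf \<mu> \<one>\<^bsub>H\<^esub> > 0" and \<eta>: "pmf \<eta> \<one>\<^bsub>K\<^esub> > 0"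
  shows "pmf (switch_walk_switch K H \<eta> \<mu>) \<one>\<^bsub>wreath K H\<^esub> > 0"
proof -
  interpret W: group "wreath K H" by (rule group_wreath[OF K H])
  interpret H: group H by fact
  have emb: "lamp_embed K H \<one>\<^bsub>K\<^esub> = \<one>\<^bsub>wreath K H\<^esub>" "base_embed K H \<one>\<^bsub>H\<^esub> = \<one>\<^bsub>wreath K H\<^esub>"
    by (auto simp: lamp_embed_def base_embed_def wreath_def lamp_one)
  have "\<one>\<^bsub>K\<^esub> \<in> set_pmf \<eta>" "\<one>\<^bsub>H\<^esub> \<in> set_pmf \<mu>"
    using \<mu> \<eta> by (auto simp: set_pmf_iff)
  then have "\<one>\<^bsub>wreath K H\<^esub> \<in> set_pmf (map_pmf (lamp_embed K H) \<eta>)"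
    "\<one>\<^bsub>wreath K H\<^esub> \<in> set_pmf (map_pmf (base_embed K H) \<mu>)"
    using emb by (metis image_eqI set_map_pmf)+
  then have "0 < pmf (map_pmf (lamp_embed K H) \<eta>) \<one>\<^bsub>wreath K H\<^esub>
      * pmf (map_pmf (base_embed K H) \<mu>) \<one>\<^bsub>wreath K H\<^esub> * pmf (map_pmf (lamp_embed K H) \<eta>) \<one>\<^bsub>wreath K H\<^esub>"
    by (simp add: pmf_positive)
  also have "\<dots> \<le> pmf (conv_pmf (wreath K H) (map_pmf (lamp_embed K H) \<eta>) (map_pmf (base_embed K H) \<mu>))
      (\<one>\<^bsub>wreath K H\<^esub> \<otimes>\<^bsub>wreath K H\<^esub> \<one>\<^bsub>wreath K H\<^esub>) * pmf (map_pmf (lamp_embed K H) \<eta>) \<one>\<^bsub>wreath K H\<^esub>"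
    by (intro mult_right_mono pmf_conv_pmf_ge) auto
  also have "\<dots> \<le> pmf (switch_walk_switch K H \<eta> \<mu>)
      (\<one>\<^bsub>wreath K H\<^esub> \<otimes>\<^bsub>wreath K H\<^esub> \<one>\<^bsub>wreath K H\<^esub> \<otimes>\<^bsub>wreath K H\<^esub> \<one>\<^bsub>wreath K H\<^esub>)"
    unfolding switch_walk_switch_def by (rule pmf_conv_pmf_ge)
  finally show ?thesis by simp
qed

text \<open>
  The finitely many remaining values are positive, so they are absorbed by enlarging the constant.
\<close>

lemma exp_bound_from_eventually:
  fixes f \<Theta> :: "nat \<Rightarrow> real"
  assumes f: "\<And>n. f n > 0" and \<Theta>: "\<And>n. n \<ge> 1 \<Longrightarrow> \<Theta> n > 0"
    and ev: "\<forall>\<^sub>F n in sequentially. exp (- M * \<Theta> n) \<le> f n"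
  shows "\<exists>C>0. \<forall>n\<ge>1. exp (- C * \<Theta> n) \<le> f n"
proof -
  obtain n0 where n0: "\<And>n. n \<ge> n0 \<Longrightarrow> exp (- M * \<Theta> n) \<le> f n"
    using ev by (auto simp: eventually_sequentially)
  define C where "C = \<bar>M\<bar> + 1 + (\<Sum>n\<in>{1..<n0}. \<bar>ln (f n)\<bar> / \<Theta> n)"
  have S: "(\<Sum>n\<in>{1..<n0}. \<bar>ln (f n)\<bar> / \<Theta> n) \<ge> 0" using \<Theta> by (intro sum_nonneg) (simp add: less_imp_le)
  have "exp (- C * \<Theta> n) \<le> f n" if n: "n \<ge> 1" for n
  proof (cases "n \<ge> n0")
    case True
    have "M * \<Theta> n \<le> C * \<Theta> n" using \<Theta>[OF n] S by (intro mult_right_mono) (auto simp: C_def)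
    then have "exp (- C * \<Theta> n) \<le> exp (- M * \<Theta> n)" by simp
    then show ?thesis using n0[OF True] by linarith
  next
    case False
    have "\<bar>ln (f n)\<bar> / \<Theta> n \<le> (\<Sum>n\<in>{1..<n0}. \<bar>ln (f n)\<bar> / \<Theta> n)"
      using False n \<Theta> by (intro member_le_sum) (auto simp: less_imp_le)
    then have "\<bar>ln (f n)\<bar> / \<Theta> n \<le> C" by (simp add: C_def)
    then have "\<bar>ln (f n)\<bar> \<le> C * \<Theta> n" using \<Theta>[OF n] by (simp add: field_simps)
    then have "exp (- C * \<Theta> n) \<le> exp (ln (f n))" by simp
    then show ?thesis using f by simp
  qed
  moreover have "C > 0" using S by (simp add: C_def)
  ultimately show ?thesis by blast
qed

text \<open>
  With \<open>j = \<lceil>k / b\<rceil>\<close> blocks the walk is confined for at least \<open>k\<close> steps; the price of the rounding is the summand \<open>2\<close>.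
\<close>

lemma even_return_ge:
  fixes H :: "('h, 'c) monoid_scheme" and K :: "('k, 'd) monoid_scheme"
    and \<mu> :: "'h pmf" and \<eta> :: "'k pmf"
  assumes H: "group H" and K: "group K" and \<mu>: "symmetric_pmf H \<mu>" and \<eta>: "symmetric_pmf K \<eta>"
    and \<eta>1: "pmf \<eta> \<one>\<^bsub>K\<^esub> > 0"
    and B: "finite B" "B \<subseteq> carrier H" and B': "B' \<subseteq> B" "\<one>\<^bsub>H\<^esub> \<in> B'"
    and \<epsilon>: "\<epsilon> > 0" "\<epsilon> \<le> 1"
    and block: "\<And>x. x \<in> B' \<Longrightarrow> \<epsilon> \<le> (\<Sum>y\<in>B'. confined_prob H \<mu> B b x y)"
    and ab: "a \<ge> 1" "b \<ge> 1"
  shows "- ln (pmf (conv_power (wreath K H) (switch_walk_switch K H \<eta> \<mu>) (2 * k)) \<one>\<^bsub>wreath K H\<^esub>) \<le>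
    (real (2 * k) / real a + real (card B)) * return_cost K \<eta> a
    + (real (2 * k) / real b + 2) * (- ln \<epsilon>) + ln (real (card B))"
proof -
  define j where "j = nat \<lceil>real k / real b\<rceil>"
  have j: "real k / real b \<le> real j" "real j \<le> real k / real b + 1"
  proof -
    have "0 \<le> real k / real b" by simp
    then show "real k / real b \<le> real j" "real j \<le> real k / real b + 1"
      unfolding j_def by linarith+
  qed
  have "real k \<le> real j * real b" using j(1) ab(2) by (simp add: field_simps)
  then have kj: "k \<le> j * b" by (metis of_nat_le_iff of_nat_mult)
  have card: "real (card B) > 0" using B(1) B' by (auto simp: card_gt_0_iff)
  let ?F = "(real (2 * k) / real a + real (card B)) * return_cost K \<eta> a"
  have "exp (- ?F) * ((\<epsilon> ^ j)\<^sup>2 / real (card B)) \<le> exp (- ?F) * confined_prob H \<mu> B (2 * k) \<one>\<^bsub>H\<^esub> \<one>\<^bsub>H\<^esub>"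
    using confined_return_ge[OF H \<mu> B B'(1) _ block B'(2) kj] \<epsilon>(1) by (intro mult_left_mono) auto
  also have "\<dots> \<le> pmf (conv_power (wreath K H) (switch_walk_switch K H \<eta> \<mu>) (2 * k)) \<one>\<^bsub>wreath K H\<^esub>"
    using return_switch_walk_switch_ge[OF H K \<mu> \<eta> \<eta>1 B subsetD[OF B'] ab(1), of "2 * k"]
    by (simp only: mult_minus_left)
  finally have "ln (exp (- ?F) * ((\<epsilon> ^ j)\<^sup>2 / real (card B)))
      \<le> ln (pmf (conv_power (wreath K H) (switch_walk_switch K H \<eta> \<mu>) (2 * k)) \<one>\<^bsub>wreath K H\<^esub>)"
    using \<epsilon> card by (intro ln_mono) auto
  moreover have "ln (exp (- ?F) * ((\<epsilon> ^ j)\<^sup>2 / real (card B))) = - ?F + 2 * real j * ln \<epsilon> - ln (real (card B))"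
    using \<epsilon> card by (simp add: ln_mult ln_div ln_realpow)
  moreover have "2 * real j * (- ln \<epsilon>) \<le> (real (2 * k) / real b + 2) * (- ln \<epsilon>)"
    using j(2) \<epsilon> by (intro mult_right_mono) auto
  ultimately show ?thesis by linarith
qed

theorem proposition6p1:
  fixes H :: "('h, 'c) monoid_scheme" and K :: "('k, 'd) monoid_scheme"
    and \<mu> :: "'h pmf" and \<eta> :: "'k pmf"
    and N :: "'h \<Rightarrow> real" and r l1 l2 :: "real \<Rightarrow> real" and D \<beta> \<gamma> :: real
  assumes H: "finitely_generated_group H"
    and mu: "symmetric_pmf H \<mu>" "pmf \<mu> \<one>\<^bsub>H\<^esub> > 0"
    and K: "finitely_generated_group K"
    and eta: "symmetric_pmf K \<eta>" "pmf \<eta> \<one>\<^bsub>K\<^esub> > 0"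
    and norm: "group_norm H N"
    and r: "\<forall>t>0. r t > 0" "continuous_on {0<..} r" "strict_mono_on {0<..} r"
    and control: "strongly_controlled H \<mu> N r"
    and vol: "comparable_on {1..} (ball_volume H N) (\<lambda>t. t powr D)"
    and r_eq: "\<beta> > 0" "pos_cont_slowly_varying l1" "\<forall>t>0. r t = t powr (1 / \<beta>) * l1 t"
    and F_K: "0 \<le> \<gamma>" "\<gamma> < 1" "pos_cont_slowly_varying l2"
      "comparable_on {1::nat..} (\<lambda>n. - ln (pmf (conv_power K \<eta> (2 * n)) \<one>\<^bsub>K\<^esub>))
         (\<lambda>n. real n powr \<gamma> * l2 (real n))"
    and l_powr: "\<forall>a>0. comparable_on {1..} (\<lambda>t. l1 (t powr a)) l1"
      "\<forall>a>0. comparable_on {1..} (\<lambda>t. l2 (t powr a)) l2"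
  shows "\<exists>C>0. \<forall>n\<ge>1.
    pmf (conv_power (wreath K H) (switch_walk_switch K H \<eta> \<mu>) n) \<one>\<^bsub>wreath K H\<^esub> \<ge>
      exp (- C * real n powr ((D * (1 - \<gamma>) + \<gamma> * \<beta>) / (D * (1 - \<gamma>) + \<beta>))
             * l1 (real n) powr (\<beta> * D * (1 - \<gamma>) / (D * (1 - \<gamma>) + \<beta>))
             * l2 (real n) powr (\<beta> / (D * (1 - \<gamma>) + \<beta>)))"
proof -
  have gH: "group H" and gK: "group K" using H K by (auto simp: finitely_generated_group_def)
  interpret H: group H by (rule gH)
  interpret K: group K by (rule gK)
  interpret W: group "wreath K H" by (rule group_wreath[OF gK gH])
  let ?q = "switch_walk_switch K H \<eta> \<mu>" and ?F = "return_cost K \<eta>"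
  define Q where "Q n = pmf (conv_power (wreath K H) ?q n) \<one>\<^bsub>wreath K H\<^esub>" for n
  define \<Theta> where "\<Theta> t = t powr ((D * (1 - \<gamma>) + \<gamma> * \<beta>) / (D * (1 - \<gamma>) + \<beta>))
    * l1 t powr (\<beta> * D * (1 - \<gamma>) / (D * (1 - \<gamma>) + \<beta>)) * l2 t powr (\<beta> / (D * (1 - \<gamma>) + \<beta>))" for t :: real
  have l1: "\<forall>t>0. l1 t > 0" "continuous_on {0<..} l1" and l2: "\<forall>t>0. l2 t > 0" "continuous_on {0<..} l2"
    using r_eq(2) F_K(3) by (auto simp: pos_cont_slowly_varying_def)
  have fin: "finite {g \<in> carrier H. N g \<le> t}" for t
    by (rule volume_growth(1)[OF gH norm vol])
  have D: "D \<ge> 0" by (rule volume_growth(2)[OF gH norm vol])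
  have s\<mu>: "set_pmf \<mu> \<subseteq> carrier H" using mu(1) by (auto simp: symmetric_pmf_def)
  have q1: "pmf ?q \<one>\<^bsub>wreath K H\<^esub> > 0"
    by (rule pmf_switch_walk_switch_one_pos[OF gH gK mu(2) eta(2)])
  have Qpos: "Q n > 0" for n
    unfolding Q_def using pmf_conv_power_one_ge[OF W.is_group, of ?q n] q1
    by (meson less_le_trans zero_less_power)
  have \<Theta>pos: "\<Theta> (real n) > 0" if "n \<ge> 1" for n :: nat
    using that l1(1) l2(1) by (simp add: \<Theta>_def less_imp_neq[THEN not_sym])

  obtain CF where CF: "CF > 0" "\<And>n. n \<ge> 1 \<Longrightarrow> ?F n \<le> CF * (real n powr \<gamma> * l2 (real n))"
    and F1: "?F 1 > 0"
  proof -
    obtain c C where c: "0 < c" "c \<le> C" and *: "\<And>n. n \<ge> 1 \<Longrightarrow>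
        c * (real n powr \<gamma> * l2 (real n)) \<le> ?F n \<and> ?F n \<le> C * (real n powr \<gamma> * l2 (real n))"
      using F_K(4) unfolding comparable_on_def return_cost_def by auto
    have "0 < c * (real 1 powr \<gamma> * l2 (real 1))" using c l2(1) by simp
    also have "\<dots> \<le> ?F 1" using * by blast
    finally show thesis using that[of C] c * by auto
  qed

  obtain \<epsilon>0 \<gamma>1 \<gamma>2 where conf: "\<epsilon>0 > 0" "\<gamma>1 > 0" "\<gamma>2 \<ge> 1"
    "\<And>n x. n \<ge> 1 \<Longrightarrow> x \<in> carrier H \<Longrightarrow> N x \<le> \<gamma>1 * r (real n) \<Longrightarrow>
      \<epsilon>0 \<le> (\<Sum>y\<in>{g \<in> carrier H. N g \<le> \<gamma>1 * r (real n)}.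
             confined_prob H \<mu> {g \<in> carrier H. N g \<le> \<gamma>2 * (\<gamma>1 * r (real n))} n x y)"
    using strongly_controlled_confinement[OF gH s\<mu> r(3) control fin] by blast
  define \<epsilon> where "\<epsilon> = min \<epsilon>0 1"
  have \<epsilon>: "\<epsilon> > 0" "\<epsilon> \<le> 1" using conf(1) by (auto simp: \<epsilon>_def)
  define B where "B b = {g \<in> carrier H. N g \<le> \<gamma>2 * (\<gamma>1 * r (real b))}" for b :: nat
  have N1: "N \<one>\<^bsub>H\<^esub> = 0" using norm by (auto simp: group_norm_def)
  have even: "- ln (Q (2 * k)) \<le> (real (2 * k) / real a + real (card (B b))) * ?F a
      + (real (2 * k) / real b + 2) * (- ln \<epsilon>) + ln (real (card (B b)))"
    if "a \<ge> 1" "b \<ge> 1" for a b k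
    unfolding Q_def
  proof (rule even_return_ge[OF gH gK mu(1) eta(1) eta(2) _ _ _ _ \<epsilon> _ that])
    let ?B' = "{g \<in> carrier H. N g \<le> \<gamma>1 * r (real b)}"
    have rb: "\<gamma>1 * r (real b) > 0" using conf(2) r(1) that by simp
    show "finite (B b)" "B b \<subseteq> carrier H" using fin by (auto simp: B_def)
    have "\<gamma>1 * r (real b) \<le> \<gamma>2 * (\<gamma>1 * r (real b))"
      using mult_right_mono[OF conf(3), of "\<gamma>1 * r (real b)"] rb by simp
    then show "?B' \<subseteq> B b" by (auto simp: B_def)
    show "\<one>\<^bsub>H\<^esub> \<in> ?B'" using rb by (simp add: N1)
    show "\<epsilon> \<le> (\<Sum>y\<in>?B'. confined_prob H \<mu> (B b) b x y)" if "x \<in> ?B'" for x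
      using conf(4)[OF \<open>b \<ge> 1\<close>, of x] that by (simp add: B_def \<epsilon>_def)
  qed
  have card_ge: "real (card (B b)) \<ge> 1" if "b \<ge> 1" for b
  proof -
    have "\<gamma>2 * (\<gamma>1 * r (real b)) > 0" using conf(2,3) r(1) that by (intro mult_pos_pos) auto
    then have "\<one>\<^bsub>H\<^esub> \<in> B b" by (simp add: B_def N1)
    then have "card (B b) > 0" using fin by (auto simp: card_gt_0_iff B_def)
    then show ?thesis by simp
  qed

  obtain CV where CV: "CV > 0" "\<And>b. b \<ge> 1 \<Longrightarrow> real (card (B b)) \<le> CV * r (real b) powr D"
  proof -
    obtain c C where c: "0 < c" "c \<le> C"
      and V: "\<And>t. t \<ge> 1 \<Longrightarrow> c * t powr D \<le> ball_volume H N t \<and> ball_volume H N t \<le> C * t powr D"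
      using vol unfolding comparable_on_def by auto
    \<comment> \<open>The volume bound concerns radii at least \<open>1\<close>; the summand \<open>1 / r 1\<close> makes \<open>\<kappa> * r b\<close> large enough
      for every \<open>b \<ge> 1\<close>.\<close>
    define \<kappa> where "\<kappa> = \<gamma>2 * \<gamma>1 + 1 / r 1"
    have r1: "r 1 > 0" and \<kappa>: "\<kappa> > 0" using r(1) conf by (auto simp: \<kappa>_def intro!: add_pos_pos)
    have "real (card (B b)) \<le> (C * \<kappa> powr D) * r (real b) powr D" if b: "b \<ge> 1" for b
    proof -
      have rb: "r 1 \<le> r (real b)"
        using strict_mono_on_leD[OF r(3), of 1 "real b"] b by simp
      have "1 \<le> (1 / r 1) * r (real b)" using rb r1 by (simp add: field_simps)
      also have "\<dots> \<le> \<kappa> * r (real b)" using conf rb r1 by (intro mult_right_mono) (auto simp: \<kappa>_def)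
      finally have k1: "1 \<le> \<kappa> * r (real b)" .
      have "\<gamma>2 * (\<gamma>1 * r (real b)) \<le> \<kappa> * r (real b)"
        using rb r1 by (simp add: \<kappa>_def distrib_right)
      then have "real (card (B b)) \<le> ball_volume H N (\<kappa> * r (real b))"
        unfolding ball_volume_def B_def using fin by (intro of_nat_mono card_mono) auto
      also have "\<dots> \<le> C * (\<kappa> * r (real b)) powr D" using V[OF k1] by simp
      also have "\<dots> = (C * \<kappa> powr D) * r (real b) powr D"
        using \<kappa> rb r1 by (simp add: powr_mult)
      finally show ?thesis .
    qed
    then show thesis using that[of "C * \<kappa> powr D"] c \<kappa> by auto
  qed

  obtain C0 where C0: "C0 > 0" and scales: "\<forall>\<^sub>F t in at_top. \<exists>a b :: nat. \<exists>W>0. a \<ge> 1 \<and> b \<ge> 1 \<and>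
    t / \<Theta> t \<le> real b \<and> t / W \<le> real a \<and>
    (real b powr (1 / \<beta>) * l1 (real b)) powr D \<le> C0 * W \<and>
    W * (real a powr \<gamma> * l2 (real a)) \<le> C0 * \<Theta> t"
    using optimal_scales[OF l1 l_powr(1) l2 l_powr(2) D r_eq(1) F_K(1,2)] unfolding \<Theta>_def by blast
  define M where "M = (1 + CV * C0) * (CF * C0)"
  define e where "e = - ln \<epsilon>"
  have M: "M > 0" using CV(1) C0 CF(1) by (simp add: M_def add_pos_pos)
  have e: "e \<ge> 0" using \<epsilon> by (simp add: e_def)
  define M' where "M' = M + (1 + 2 * (M / ?F 1)) * e + M / ?F 1 + M / ?F 1 * (- ln (pmf ?q \<one>\<^bsub>wreath K H\<^esub>))"
  \<comment> \<open>One more step may do nothing, which extends the bound from even to odd times at a bounded cost.\<close>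
  have odd: "- ln (Q (Suc n)) \<le> - ln (Q n) - ln (pmf ?q \<one>\<^bsub>wreath K H\<^esub>)" for n
  proof -
    have "Q n * pmf ?q \<one>\<^bsub>wreath K H\<^esub> \<le> Q (Suc n)"
      using pmf_conv_pmf_ge[of "conv_power (wreath K H) ?q n" "\<one>\<^bsub>wreath K H\<^esub>" ?q "\<one>\<^bsub>wreath K H\<^esub>" "wreath K H"]
      by (simp add: Q_def)
    then have "ln (Q n * pmf ?q \<one>\<^bsub>wreath K H\<^esub>) \<le> ln (Q (Suc n))"
      using Qpos q1 by (intro ln_mono) auto
    then show ?thesis using Qpos[of n] q1 by (simp add: ln_mult_pos)
  qed
  have "\<forall>\<^sub>F n in sequentially. exp (- M' * \<Theta> (real n)) \<le> Q n"
    using eventually_compose_filterlim[OF scales filterlim_real_sequentially] eventually_ge_at_top[of 1]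
  proof eventually_elim
    case (elim n)
    then obtain a b :: nat and W where W: "W > 0" and a: "a \<ge> 1" and b: "b \<ge> 1"
      and nb: "real n / \<Theta> (real n) \<le> real b" and na: "real n / W \<le> real a"
      and rb: "(real b powr (1 / \<beta>) * l1 (real b)) powr D \<le> C0 * W"
      and Wa: "W * (real a powr \<gamma> * l2 (real a)) \<le> C0 * \<Theta> (real n)" by blast
    define V where "V = real (card (B b))"
    let ?T = "\<Theta> (real n)"
    have T: "?T > 0" using \<Theta>pos elim(2) by simp
    have Fa: "?F 1 \<le> ?F a" "?F a \<ge> 0"
      using return_cost_mono[OF gK eta a] return_cost_nonneg[OF gK eta] by auto
    have "V \<le> CV * r (real b) powr D" using CV(2)[OF b] by (simp add: V_def)
    also have "\<dots> \<le> CV * (C0 * W)" using r_eq(3) b rb CV(1) by (intro mult_left_mono) auto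
    finally have VW: "V \<le> (CV * C0) * W" by simp
    have "W * ?F a \<le> W * (CF * (real a powr \<gamma> * l2 (real a)))"
      using CF(2)[OF a] W by (intro mult_left_mono) auto
    also have "\<dots> = CF * (W * (real a powr \<gamma> * l2 (real a)))" by (simp only: mult_ac)
    also have "\<dots> \<le> CF * (C0 * ?T)" using Wa CF(1) by (intro mult_left_mono) auto
    finally have WF: "W * ?F a \<le> CF * C0 * ?T" by simp
    have V1: "V \<ge> 1" using card_ge[OF b] by (simp add: V_def)
    have cost: "(W + V) * ?F a \<le> M * ?T"
    proof -
      have "(W + V) * ?F a \<le> (1 + CV * C0) * W * ?F a"
        using VW Fa(2) by (intro mult_right_mono) (auto simp: distrib_right)
      also have "\<dots> = (1 + CV * C0) * (W * ?F a)" by (simp only: mult_ac)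
      also have "\<dots> \<le> (1 + CV * C0) * (CF * C0 * ?T)"
        using WF CV(1) C0 by (intro mult_left_mono) auto
      finally show ?thesis by (simp add: M_def mult_ac)
    qed
    \<comment> \<open>The lamp cost dominates the volume, because every site is charged \<open>?F a \<ge> ?F 1 > 0\<close>. So \<open>ln V \<le> V\<close>, and with
      \<open>V \<ge> 1\<close> also all constants, are absorbed in a multiple of \<open>\<Theta> n\<close>.\<close>
    have "V * ?F 1 \<le> V * ?F a" using Fa V1 by (intro mult_left_mono) auto
    also have "\<dots> \<le> (W + V) * ?F a" using Fa W by (intro mult_right_mono) auto
    finally have V_le: "V \<le> M / ?F 1 * ?T" using cost F1 by (simp add: field_simps)
    have even_bound: "- ln (Q (2 * k)) \<le> M * ?T + (?T + 2 * (M / ?F 1 * ?T)) * e + M / ?F 1 * ?T"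
      if k: "2 * k \<le> n" for k
    proof -
      have "real (2 * k) / real a \<le> real n / real a" using k a by (intro divide_right_mono) auto
      also have "\<dots> \<le> W" using na W a by (simp add: field_simps)
      finally have 1: "real (2 * k) / real a \<le> W" .
      have "real (2 * k) / real b \<le> real n / real b" using k b by (intro divide_right_mono) auto
      also have "\<dots> \<le> ?T" using nb T b by (simp add: field_simps)
      finally have 2: "real (2 * k) / real b \<le> ?T" .
      have "- ln (Q (2 * k)) \<le> (real (2 * k) / real a + V) * ?F a + (real (2 * k) / real b + 2) * e + ln V"
        using even[OF a b] by (simp add: V_def e_def)
      also have "\<dots> \<le> M * ?T + (?T + 2 * (M / ?F 1 * ?T)) * e + M / ?F 1 * ?T"
      proof (intro add_mono)
        have "(real (2 * k) / real a + V) * ?F a \<le> (W + V) * ?F a"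
          using 1 Fa(2) by (intro mult_right_mono) auto
        then show "(real (2 * k) / real a + V) * ?F a \<le> M * ?T" using cost by linarith
        show "(real (2 * k) / real b + 2) * e \<le> (?T + 2 * (M / ?F 1 * ?T)) * e"
          using 2 V_le V1 e by (intro mult_right_mono) linarith+
        show "ln V \<le> M / ?F 1 * ?T" using ln_le_minus_one[of V] V1 V_le by linarith
      qed
      finally show ?thesis .
    qed
    have lnq: "- ln (pmf ?q \<one>\<^bsub>wreath K H\<^esub>) \<ge> 0" using q1 by (simp add: pmf_le_1)
    have "1 * (- ln (pmf ?q \<one>\<^bsub>wreath K H\<^esub>)) \<le> (M / ?F 1 * ?T) * (- ln (pmf ?q \<one>\<^bsub>wreath K H\<^esub>))"
      using V_le V1 lnq by (intro mult_right_mono) auto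
    moreover have "- ln (Q n) \<le> M * ?T + (?T + 2 * (M / ?F 1 * ?T)) * e + M / ?F 1 * ?T
        - ln (pmf ?q \<one>\<^bsub>wreath K H\<^esub>)"
    proof (cases "even n")
      case True
      then have "n = 2 * (n div 2)" by simp
      then show ?thesis using even_bound[of "n div 2"] lnq by simp
    next
      case False
      then have "n = Suc (2 * (n div 2))" by simp
      then show ?thesis using even_bound[of "n div 2"] odd[of "2 * (n div 2)"] by simp
    qed
    ultimately have "- ln (Q n) \<le> M' * ?T"
      by (simp add: M'_def algebra_simps)
    then have "exp (- M' * ?T) \<le> exp (ln (Q n))" by simp
    then show ?case using Qpos by simp
  qed
  then have "\<exists>C>0. \<forall>n\<ge>1. exp (- C * \<Theta> (real n)) \<le> Q n"
    using Qpos \<Theta>pos by (intro exp_bound_from_eventually) auto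
  then show ?thesis unfolding Q_def \<Theta>_def by (simp only: mult.assoc)
qed

end
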